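(* There is an absolute constant $C$ such that every finite set $S\subset\mathbb R^2$ that is not contained in a conic and has no three points on a line determines at least $\frac{1}{120}|S|^4-C|S|^3$ ordinary conics.
   Context: A conic is the zero set in $\mathbb R^2$ of a real polynomial of degree $2$ in two variables; in particular a union of two distinct lines is a conic. A conic is an ordinary conic for a finite set $S\subset\mathbb R^2$ (and $S$ is said to determine it) if it contains exactly five points of $S$ and it is the only conic containing these five points. *)

theory Defs
  imports "HOL-Analysis.Analysis"
begin

text \<open>The polynomial has total degree exactly 2, i.e. its homogeneous part of degree 2 is
  nonzero.  Degenerate zero sets (pairs of lines, a double line,
  a point, the empty set) count as conics.  A conic is a point set, not a polynomial up to scaling.\<close>

definition plane_conic :: "(real \<times> real) set \<Rightarrow> bool" where
  "plane_conic Q \<longleftrightarrow>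
    (\<exists>a b c d e f :: real. (a, b, c) \<noteq> (0, 0, 0) \<and>
      Q = {(x, y). a * x\<^sup>2 + b * x * y + c * y\<^sup>2 + d * x + e * y + f = 0})"

definition ordinary_conic :: "(real \<times> real) set \<Rightarrow> (real \<times> real) set \<Rightarrow> bool" where
  "ordinary_conic S Q \<longleftrightarrow>
    plane_conic Q \<and> card (Q \<inter> S) = 5 \<and> (\<forall>Q'. plane_conic Q' \<and> Q \<inter> S \<subseteq> Q' \<longrightarrow> Q' = Q)"

text \<open>Counting ordinary conics with \<^const>\<open>card\<close> is meaningful:\<close>

lemma finite_ordinary_conics:
  assumes "finite S"
  shows "finite {Q. ordinary_conic S Q}"
proof (rule finite_imageD)
  show "finite ((\<lambda>Q. Q \<inter> S) ` {Q. ordinary_conic S Q})"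
    by (rule finite_subset[of _ "Pow S"]) (use assms in auto)
  show "inj_on (\<lambda>Q. Q \<inter> S) {Q. ordinary_conic S Q}"
  proof (rule inj_onI)
    fix Q R
    assume "Q \<in> {Q. ordinary_conic S Q}" "R \<in> {Q. ordinary_conic S Q}"
      and eq: "Q \<inter> S = R \<inter> S"
    then have "plane_conic Q" "\<forall>Q'. plane_conic Q' \<and> R \<inter> S \<subseteq> Q' \<longrightarrow> Q' = R"
      by (simp_all add: ordinary_conic_def)
    moreover have "R \<inter> S \<subseteq> Q"
      using eq by blast
    ultimately show "Q = R"
      by blast
  qed
qed

end

theory Submission
  imports Defs
begin

text \<open>
  Write \<open>n\<close> for the number of points of \<open>S\<close>. For \<open>n \<ge> 7\<close> there are at least \<open>(n choose 4) / 5\<close>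
  ordinary conics. The proof averages the Kelly-Moser argument for ordinary lines over all triples of
  points of \<open>S\<close>.

  Fix four points \<open>a, b, c, d\<close>. The conics through \<open>a, b, c\<close> that avoid \<open>d\<close> form an affine plane, in
  which every other point of \<open>S\<close> is a line (the conics through it) and two lines are parallel iff
  their points lie on a common conic with \<open>a, b, c, d\<close>. So a line without parallels is an
  ordinary conic through \<open>a, b, c, d\<close>, and a simple crossing is an ordinary conic through \<open>a, b, c\<close>.
  At a vertex of the convex hull of all crossings with at least three lines, a middle line has no
  parallel. Hence the number of lines without parallel plus the number of simple hull vertices is
  at least 3, with one exception: exactly two lines without parallel and a hull with four triple vertices,
  two on each of these lines.

  Conversely, let \<open>\<Gamma>\<close> be the five points of an ordinary conic. Moving that conic to infinity gives the
  remaining points five coordinates, one for each \<open>g \<in> \<Gamma>\<close> (the pencil through \<open>\<Gamma> - {g}\<close>), any two of which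
  determine the point. If a simple hull vertex for \<open>a, b, c, d\<close> is the conic of \<open>\<Gamma> = {a, b, c, e, f}\<close>,
  then \<open>d\<close> is extremal in the coordinates \<open>e\<close> and \<open>f\<close>. For every pair of coordinates there
  are at most four such points, which would give the constant \<open>1/120\<close> if the exceptional case never
  occurred. In the exceptional case a coordinate of \<open>\<Gamma>\<close> has exactly two maximal and two
  minimal points, and then a pigeonhole argument shows that the bound four is missed for enough
  pairs of coordinates to compensate exactly.
\<close>

section \<open>Hulls of crossings in line arrangements\<close>

text \<open>Line \<open>i\<close> is the zero set of the form
  \<open>a i * x + b i * y + c i\<close>. By \<open>parallel_disjoint\<close>, different indices
  give different lines, since coinciding lines would be parallel and meet.\<close>

locale line_arrangement =
  fixes A :: "'i set" and a b c :: "'i \<Rightarrow> real"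
  assumes finite_lines: "finite A"
    and three_lines: "3 \<le> card A"
    and normal_nonzero: "i \<in> A \<Longrightarrow> a i \<noteq> 0 \<or> b i \<noteq> 0"
    and parallel_disjoint: "\<lbrakk>i \<in> A; j \<in> A; i \<noteq> j; a i * b j = a j * b i;
        a i * fst x + b i * snd x + c i = 0\<rbrakk> \<Longrightarrow> a j * fst x + b j * snd x + c j \<noteq> 0"
    and not_all_parallel: "\<exists>i\<in>A. \<exists>j\<in>A. a i * b j \<noteq> a j * b i"
begin

definition F :: "'i \<Rightarrow> real \<times> real \<Rightarrow> real" where
  "F i x = a i * fst x + b i * snd x + c i"

definition par :: "'i \<Rightarrow> 'i \<Rightarrow> bool" where
  "par i j \<longleftrightarrow> a i * b j = a j * b i"

definition X :: "(real \<times> real) set" where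
  "X = {x. \<exists>i\<in>A. \<exists>j\<in>A. i \<noteq> j \<and> F i x = 0 \<and> F j x = 0}"

definition V :: "(real \<times> real) set" where
  "V = {x. x extreme_point_of (convex hull X)}"

definition lines_at :: "real \<times> real \<Rightarrow> 'i set" where
  "lines_at x = {i \<in> A. F i x = 0}"

definition single :: "'i \<Rightarrow> bool" where
  "single q \<longleftrightarrow> q \<in> A \<and> (\<forall>j\<in>A. par q j \<longrightarrow> j = q)"

definition simple_vertices :: "(real \<times> real) set" where
  "simple_vertices = {v \<in> V. card (lines_at v) = 2}"

text \<open>Meant for a hull vertex \<open>v\<close>, where the crossings on each line form part of
  a ray from \<open>v\<close>: the rays of \<open>l\<close> and \<open>r\<close> then lie on
  opposite sides of \<open>m\<close>. The order of \<open>l\<close> and \<open>r\<close> fixes the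
  sign of \<open>F m\<close>.\<close>

definition mid :: "real \<times> real \<Rightarrow> 'i \<Rightarrow> 'i \<Rightarrow> 'i \<Rightarrow> bool" where
  "mid v m l r \<longleftrightarrow> {m, l, r} \<subseteq> lines_at v \<and> distinct [m, l, r] \<and>
     (\<forall>x\<in>X. F l x = 0 \<longrightarrow> x \<noteq> v \<longrightarrow> F m x < 0) \<and>
     (\<forall>x\<in>X. F r x = 0 \<longrightarrow> x \<noteq> v \<longrightarrow> 0 < F m x)"

text \<open>The exceptional case of the hull argument.\<close>

definition bad_line :: "'i \<Rightarrow> bool" where
  "bad_line q \<longleftrightarrow> (\<exists>v\<in>V. \<exists>w\<in>V. \<exists>l r l' r'. v \<noteq> w \<and> distinct [q, l, r, l', r'] \<and>
     lines_at v = {q, l, r} \<and> lines_at w = {q, l', r'} \<and> par l r' \<and> par r l')"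

section \<open>Parallel lines and crossings\<close>

lemma par_sym: "par i j \<Longrightarrow> par j i"
  by (simp add: par_def)

text \<open>A zero normal would be parallel to everything, so transitivity needs a middle index with
  nonzero normal.\<close>

lemma par_trans:
  assumes "j \<in> A" "par i j" "par j k"
  shows "par i k"
proof -
  have e: "a i * b j = a j * b i" "a j * b k = a k * b j"
    using assms by (simp_all add: par_def)
  have "a j * (a i * b k - a k * b i) = 0" "b j * (a i * b k - a k * b i) = 0"
    using e by algebra+
  then show ?thesis
    using normal_nonzero[OF assms(1)] by (auto simp: par_def)
qed

lemma not_par_at:
  assumes "i \<in> A" "j \<in> A" "i \<noteq> j" "F i x = 0" "F j x = 0"
  shows "\<not> par i j"
  using parallel_disjoint assms unfolding par_def F_def by blast

lemma meet:
  assumes "\<not> par i j"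
  obtains x where "F i x = 0" "F j x = 0"
proof -
  define D where "D = a i * b j - a j * b i"
  have D: "D \<noteq> 0"
    using assms by (simp add: D_def par_def)
  \<comment> \<open>Cramer's rule for the two line equations.\<close>
  let ?x = "((b i * c j - b j * c i) / D, (a j * c i - a i * c j) / D)"
  have "D * F i ?x = 0" "D * F j ?x = 0"
    using D by (simp_all add: F_def distrib_left) (simp_all add: D_def algebra_simps)
  with D show ?thesis
    using that[of ?x] by simp
qed

lemma meet_unique:
  assumes "\<not> par i j" "F i x = 0" "F j x = 0" "F i y = 0" "F j y = 0"
  shows "x = y"
proof -
  have D: "a i * b j - a j * b i \<noteq> 0"
    using assms by (simp add: par_def)
  have "(a i * b j - a j * b i) * (fst x - fst y) = 0" "(a i * b j - a j * b i) * (snd x - snd y) = 0"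
    using assms(2-) unfolding F_def by algebra+
  with D show ?thesis
    by (simp add: prod_eq_iff)
qed

lemma line_unique:
  assumes "i \<in> A" "j \<in> A" "F i x = 0" "F j x = 0" "F i y = 0" "F j y = 0" "x \<noteq> y"
  shows "i = j"
  using assms not_par_at meet_unique by metis

lemma par_const:
  assumes "i \<in> A" "par i j" "F i x = 0" "F i y = 0"
  shows "F j x = F j y"
proof -
  have "a i * (F j x - F j y) = 0" "b i * (F j x - F j y) = 0"
    using assms(2-) unfolding par_def F_def by algebra+
  then show ?thesis
    using normal_nonzero[OF assms(1)] by auto
qed

lemma in_XI: "\<lbrakk>i \<in> A; j \<in> A; i \<noteq> j; F i x = 0; F j x = 0\<rbrakk> \<Longrightarrow> x \<in> X"
  by (auto simp: X_def)

lemma finite_X: "finite X"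
proof -
  have "X \<subseteq> (\<Union>i\<in>A. \<Union>j\<in>A - {i}. {x. F i x = 0 \<and> F j x = 0})"
    by (auto simp: X_def)
  moreover have "finite {x. F i x = 0 \<and> F j x = 0}" if "i \<in> A" "j \<in> A - {i}" for i j
  proof (cases "\<exists>y. F i y = 0 \<and> F j y = 0")
    case True
    then obtain y where y: "F i y = 0" "F j y = 0" by blast
    then have "{x. F i x = 0 \<and> F j x = 0} \<subseteq> {y}"
      using that not_par_at[of i j y] meet_unique[of i j _ y] by blast
    then show ?thesis
      by (rule finite_subset) simp
  next
    case False
    then have "{x. F i x = 0 \<and> F j x = 0} = {}"
      by blast
    then show ?thesis
      by (simp only: finite.emptyI)
  qed
  ultimately show ?thesis
    using finite_lines by (meson finite_UN_I finite_Diff finite_subset)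
qed

section \<open>Vertices of the convex hull\<close>

lemma V_subset: "V \<subseteq> X"
  using extreme_point_of_convex_hull by (auto simp: V_def)

lemma finite_V: "finite V"
  using V_subset finite_X finite_subset by blast

lemma hull_V: "convex hull V = convex hull X"
  using Krein_Milman_polytope[OF finite_X] by (simp add: V_def)

lemma not_between:
  assumes "v \<in> V" "x \<in> X" "y \<in> X"
  shows "v \<notin> open_segment x y"
  using assms hull_inc[of _ X convex] by (auto simp: V_def extreme_point_of_def)

text \<open>\<open>(- b i, a i)\<close> is the normal turned by a right angle, hence a direction of
  line \<open>i\<close>; \<open>t\<close> comes from projecting \<open>x - v\<close> onto
  it.\<close>

lemma line_param:
  assumes "i \<in> A" "F i v = 0" "F i x = 0"
  obtains t where "x = v + t *\<^sub>R (- b i, a i)"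
proof -
  define N where "N = (a i)\<^sup>2 + (b i)\<^sup>2"
  have N: "N \<noteq> 0"
    using normal_nonzero[OF assms(1)] by (auto simp: N_def sum_power2_eq_zero_iff)
  define t where "t = (a i * (snd x - snd v) - b i * (fst x - fst v)) / N"
  have tN: "N * t = a i * (snd x - snd v) - b i * (fst x - fst v)"
    using N by (simp add: t_def)
  have "N * (fst x - fst v + t * b i) = 0" "N * (snd x - snd v - t * a i) = 0"
    using assms(2,3) tN unfolding F_def N_def by algebra+
  then have "x = v + t *\<^sub>R (- b i, a i)"
    using N by (auto simp: prod_eq_iff)
  then show ?thesis
    using that by blast
qed

text \<open>An extreme point is not strictly between two crossings, so the crossings on a line
  through \<open>v\<close> cannot lie on both sides of \<open>v\<close>; only a zero direction is
  left.\<close>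

lemma same_side:
  assumes "v \<in> V" "v + s *\<^sub>R w \<in> X" "v + t *\<^sub>R w \<in> X" "s < 0" "0 < t"
  shows "w = 0"
proof (rule ccontr)
  assume "w \<noteq> 0"
  \<comment> \<open>The weight \<open>(-s)/(t-s)\<close> makes the parameters \<open>s\<close> and
    \<open>t\<close> average to 0.\<close>
  have "v = (1 - (-s)/(t-s)) *\<^sub>R (v + s *\<^sub>R w) + ((-s)/(t-s)) *\<^sub>R (v + t *\<^sub>R w)"
  proof -
    have "(1 - (-s)/(t-s)) * s + ((-s)/(t-s)) * t = 0"
      using assms(4,5) by (simp add: field_simps)
    then have "((1 - (-s)/(t-s)) * s + ((-s)/(t-s)) * t) *\<^sub>R w = 0"
      by simp
    then show ?thesis
      by (simp add: algebra_simps)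
  qed
  moreover have "0 < (-s)/(t-s)" "(-s)/(t-s) < 1"
    using assms(4,5) by (simp_all add: field_simps)
  moreover have "v + s *\<^sub>R w \<noteq> v + t *\<^sub>R w"
    using \<open>w \<noteq> 0\<close> assms(4,5) by simp
  ultimately have "v \<in> open_segment (v + s *\<^sub>R w) (v + t *\<^sub>R w)"
    unfolding in_segment by blast
  then show False
    using not_between[OF assms(1-3)] by blast
qed

lemma ray:
  assumes "v \<in> V" "i \<in> lines_at v"
  obtains \<sigma> :: real where "\<sigma> \<noteq> 0"
    "\<And>x. x \<in> X \<Longrightarrow> F i x = 0 \<Longrightarrow> \<exists>t\<ge>0. x = v + t *\<^sub>R (\<sigma> *\<^sub>R (- b i, a i))"
proof -
  let ?w = "(- b i, a i)"
  have i: "i \<in> A" "F i v = 0"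
    using assms by (auto simp: lines_at_def)
  have w: "?w \<noteq> 0"
    using normal_nonzero[OF i(1)] by (auto simp: zero_prod_def)
  show ?thesis
  proof (cases "\<exists>t>0. v + t *\<^sub>R ?w \<in> X")
    case True
    then obtain t where t: "t > 0" "v + t *\<^sub>R ?w \<in> X" by blast
    have "\<exists>t\<ge>0. x = v + t *\<^sub>R (1 *\<^sub>R ?w)" if x: "x \<in> X" "F i x = 0" for x
    proof -
      obtain s where s: "x = v + s *\<^sub>R ?w"
        using line_param[OF i x(2)] by blast
      then have "\<not> s < 0"
        using same_side[OF assms(1) _ t(2) _ t(1)] x w by blast
      then show ?thesis
        using s by (intro exI[of _ s]) auto
    qed
    then show ?thesis
      using that[of 1] by auto
  next
    case False
    have "\<exists>t\<ge>0. x = v + t *\<^sub>R ((-1) *\<^sub>R ?w)" if x: "x \<in> X" "F i x = 0" for x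
    proof -
      obtain s where s: "x = v + s *\<^sub>R ?w"
        using line_param[OF i x(2)] by blast
      then have "\<not> s > 0"
        using False x by auto
      then show ?thesis
        using s by (intro exI[of _ "-s"]) auto
    qed
    then show ?thesis
      using that[of "-1"] by auto
  qed
qed

lemma F_along: "F m v = 0 \<Longrightarrow> F m (v + t *\<^sub>R (s *\<^sub>R (- b i, a i))) = t * s * (a i * b m - a m * b i)"
proof -
  assume "F m v = 0"
  then have "c m = - a m * fst v - b m * snd v"
    by (simp add: F_def)
  then show ?thesis
    by (simp add: F_def algebra_simps)
qed

section \<open>Middle lines at a vertex\<close>

lemma mid_aux:
  assumes "{m, l, r} \<subseteq> lines_at v" "distinct [m, l, r]"
    and l: "\<And>x. x \<in> X \<Longrightarrow> F l x = 0 \<Longrightarrow> \<exists>t\<ge>0. x = v + t *\<^sub>R (\<sigma> *\<^sub>R (- b l, a l))"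
    and r: "\<And>x. x \<in> X \<Longrightarrow> F r x = 0 \<Longrightarrow> \<exists>t\<ge>0. x = v + t *\<^sub>R (\<tau> *\<^sub>R (- b r, a r))"
    and neg: "\<sigma> * (a l * b m - a m * b l) < 0" and pos: "0 < \<tau> * (a r * b m - a m * b r)"
  shows "mid v m l r"
proof -
  have m: "F m v = 0"
    using assms(1) by (simp add: lines_at_def)
  have "F m x < 0" if x: "x \<in> X" "F l x = 0" "x \<noteq> v" for x
  proof -
    obtain t where t: "t \<ge> 0" "x = v + t *\<^sub>R (\<sigma> *\<^sub>R (- b l, a l))"
      using l[OF x(1,2)] by blast
    with x(3) have "t > 0"
      by (cases "t = 0") (simp_all del: scaleR_Pair)
    then show ?thesis
      using t(2) F_along[OF m] neg by (simp add: mult.assoc mult_pos_neg)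
  qed
  moreover have "0 < F m x" if x: "x \<in> X" "F r x = 0" "x \<noteq> v" for x
  proof -
    obtain t where t: "t \<ge> 0" "x = v + t *\<^sub>R (\<tau> *\<^sub>R (- b r, a r))"
      using r[OF x(1,2)] by blast
    with x(3) have "t > 0"
      by (cases "t = 0") (simp_all del: scaleR_Pair)
    then show ?thesis
      using t(2) F_along[OF m] pos by (simp add: mult.assoc)
  qed
  ultimately show ?thesis
    using assms(1,2) by (auto simp: mid_def)
qed

lemma mid_sides:
  assumes "{m, l, r} \<subseteq> lines_at v" "distinct [m, l, r]"
    and l: "\<And>x. x \<in> X \<Longrightarrow> F l x = 0 \<Longrightarrow> \<exists>t\<ge>0. x = v + t *\<^sub>R (\<sigma> *\<^sub>R (- b l, a l))"
    and r: "\<And>x. x \<in> X \<Longrightarrow> F r x = 0 \<Longrightarrow> \<exists>t\<ge>0. x = v + t *\<^sub>R (\<tau> *\<^sub>R (- b r, a r))"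
    and opp: "(\<sigma> * (a l * b m - a m * b l)) * (\<tau> * (a r * b m - a m * b r)) < 0"
  shows "mid v m l r \<or> mid v m r l"
proof -
  have "{m, r, l} \<subseteq> lines_at v" "distinct [m, r, l]"
    using assms(1,2) by auto
  note mid_aux[OF assms(1,2) l r] mid_aux[OF this r l]
  then show ?thesis
    using opp mult_less_0_iff by blast
qed

text \<open>For each of the three lines, multiply the values that tell on which side of it the rays
  of the other two lie. The product of these three numbers is minus a nonzero square, so one of them
  is negative, and the corresponding line is in the middle.\<close>

lemma mid_exists:
  assumes "v \<in> V" "{i, j, k} \<subseteq> lines_at v" "distinct [i, j, k]"
  obtains m l r where "mid v m l r" "{m, l, r} = {i, j, k}"
proof -
  obtain \<rho> where \<rho>: "\<rho> \<noteq> 0" "\<And>x. x \<in> X \<Longrightarrow> F i x = 0 \<Longrightarrow> \<exists>t\<ge>0. x = v + t *\<^sub>R (\<rho> *\<^sub>R (- b i, a i))"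
    using ray[OF assms(1)] assms(2) by (metis insert_subset)
  obtain \<sigma> where \<sigma>: "\<sigma> \<noteq> 0" "\<And>x. x \<in> X \<Longrightarrow> F j x = 0 \<Longrightarrow> \<exists>t\<ge>0. x = v + t *\<^sub>R (\<sigma> *\<^sub>R (- b j, a j))"
    using ray[OF assms(1)] assms(2) by (metis insert_subset)
  obtain \<tau> where \<tau>: "\<tau> \<noteq> 0" "\<And>x. x \<in> X \<Longrightarrow> F k x = 0 \<Longrightarrow> \<exists>t\<ge>0. x = v + t *\<^sub>R (\<tau> *\<^sub>R (- b k, a k))"
    using ray[OF assms(1)] assms(2) by (metis insert_subset)
  have np: "\<not> par i j" "\<not> par j k" "\<not> par i k"
    using assms(2,3) not_par_at[of i j v] not_par_at[of j k v] not_par_at[of i k v]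
    by (auto simp: lines_at_def)
  define p where "p = a i * b j - a j * b i"
  define q where "q = a j * b k - a k * b j"
  define s where "s = a k * b i - a i * b k"
  have nz: "p \<noteq> 0" "q \<noteq> 0" "s \<noteq> 0"
    using np by (auto simp: p_def q_def s_def par_def)
  have "0 < (\<sigma> * p * \<tau> * s)\<^sup>2 * (\<rho> * q)\<^sup>2"
    using nz \<rho>(1) \<sigma>(1) \<tau>(1) by simp
  also have "\<dots> = ((\<sigma> * p) * (\<tau> * s)) * (((\<rho> * p) * (\<tau> * q)) * ((\<rho> * s) * (\<sigma> * q)))"
    by (simp add: power2_eq_square)
  finally consider "0 < (\<sigma> * p) * (\<tau> * s)" | "0 < (\<rho> * p) * (\<tau> * q)" | "0 < (\<rho> * s) * (\<sigma> * q)"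
    by (smt (verit) mult_nonneg_nonpos mult_nonpos_nonneg mult_nonpos_nonpos)
  then show ?thesis
  proof cases
    case 1
    have "a j * b i - a i * b j = - p" "a k * b i - a i * b k = s"
      by (simp_all add: p_def s_def)
    with 1 have "(\<sigma> * (a j * b i - a i * b j)) * (\<tau> * (a k * b i - a i * b k)) < 0"
      by simp
    then have "mid v i j k \<or> mid v i k j"
      using assms(2,3) by (intro mid_sides[OF _ _ \<sigma>(2) \<tau>(2)]) auto
    then show ?thesis
      using that[of i j k] that[of i k j] by (auto simp: insert_commute)
  next
    case 2
    have "a i * b j - a j * b i = p" "a k * b j - a j * b k = - q"
      by (simp_all add: p_def q_def)
    with 2 have "(\<rho> * (a i * b j - a j * b i)) * (\<tau> * (a k * b j - a j * b k)) < 0"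
      by simp
    then have "mid v j i k \<or> mid v j k i"
      using assms(2,3) by (intro mid_sides[OF _ _ \<rho>(2) \<tau>(2)]) auto
    then show ?thesis
      using that[of j i k] that[of j k i] by (auto simp: insert_commute)
  next
    case 3
    have "a i * b k - a k * b i = - s" "a j * b k - a k * b j = q"
      by (simp_all add: s_def q_def)
    with 3 have "(\<rho> * (a i * b k - a k * b i)) * (\<sigma> * (a j * b k - a k * b j)) < 0"
      by simp
    then have "mid v k i j \<or> mid v k j i"
      using assms(2,3) by (intro mid_sides[OF _ _ \<rho>(2) \<sigma>(2)]) auto
    then show ?thesis
      using that[of k i j] that[of k j i] by (auto simp: insert_commute)
  qed
qed

text \<open>A parallel of \<open>m\<close> would meet \<open>l\<close> and \<open>r\<close> on different sides of \<open>m\<close>.\<close>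

lemma mid_single:
  assumes "mid v m l r"
  shows "single m"
  unfolding single_def
proof (intro conjI ballI impI)
  have at: "m \<in> A" "l \<in> A" "r \<in> A" "F m v = 0" "F l v = 0" "F r v = 0" "m \<noteq> l" "m \<noteq> r"
    using assms by (auto simp: mid_def lines_at_def)
  show "m \<in> A"
    by (fact at)
  fix k assume k: "k \<in> A" "par m k"
  show "k = m"
  proof (rule ccontr)
    assume km: "k \<noteq> m"
    have kv: "F k v \<noteq> 0"
      using not_par_at[of m k v] at k km by auto
    have "\<not> par k l" "\<not> par k r"
      using par_trans[OF k(1,2)] not_par_at[of m l v] not_par_at[of m r v] at by auto
    then obtain x y where xy: "F k x = 0" "F l x = 0" "F k y = 0" "F r y = 0"
      using meet by metis
    have "F m x < 0" "0 < F m y"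
      using assms xy kv at k in_XI[of k l x] in_XI[of k r y] by (auto simp: mid_def)
    moreover have "F m x = F m y"
      using par_const[of k m x y] k xy par_sym by auto
    ultimately show False
      by simp
  qed
qed

text \<open>A crossing of \<open>l\<close> and \<open>r'\<close> would lie on both sides of
  \<open>q\<close>, once seen from \<open>v\<close> and once from \<open>w\<close>; likewise for
  \<open>r\<close> and \<open>l'\<close>. Therefore \<open>l\<close> and \<open>l'\<close> do cross,
  on the negative side of \<open>q\<close>, and \<open>r\<close> and \<open>r'\<close> on the
  positive side.\<close>

lemma two_mids:
  assumes "mid v q l r" "mid w q l' r'" "v \<noteq> w"
  shows "par l r'" "par r l'" "distinct [q, l, r, l', r']"
    "\<exists>x\<in>X. F q x < 0" "\<exists>x\<in>X. 0 < F q x"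
proof -
  have at: "q \<in> A" "l \<in> A" "r \<in> A" "l' \<in> A" "r' \<in> A" "F q v = 0" "F l v = 0" "F r v = 0"
    "F q w = 0" "F l' w = 0" "F r' w = 0" "q \<noteq> l" "q \<noteq> r" "l \<noteq> r" "q \<noteq> l'" "q \<noteq> r'" "l' \<noteq> r'"
    using assms by (auto simp: mid_def lines_at_def)
  have off: "F l w \<noteq> 0" "F r w \<noteq> 0" "F l' v \<noteq> 0" "F r' v \<noteq> 0"
    using line_unique[of q l v w] line_unique[of q r v w] line_unique[of q l' v w]
      line_unique[of q r' v w] at assms(3) by auto
  then show "distinct [q, l, r, l', r']"
    using at by auto
  show lr: "par l r'"
  proof (rule ccontr)
    assume "\<not> par l r'"
    then obtain x where x: "F l x = 0" "F r' x = 0"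
      using meet by metis
    then have "x \<in> X" "x \<noteq> v" "x \<noteq> w"
      using at off in_XI[of l r' x] by auto
    then show False
      using assms x unfolding mid_def by force
  qed
  show rl: "par r l'"
  proof (rule ccontr)
    assume "\<not> par r l'"
    then obtain x where x: "F r x = 0" "F l' x = 0"
      using meet by metis
    then have "x \<in> X" "x \<noteq> v" "x \<noteq> w"
      using at off in_XI[of r l' x] by auto
    then show False
      using assms x unfolding mid_def by force
  qed
  have "\<not> par l l'" "\<not> par r r'"
    using par_trans[OF at(2) par_sym[OF lr]] par_trans[OF at(3) par_sym[OF rl]]
      not_par_at[of r' l' w] not_par_at[of l' r' w] at by auto
  then obtain x y where xy: "F l x = 0" "F l' x = 0" "F r y = 0" "F r' y = 0"
    using meet by metis
  have "x \<in> X" "y \<in> X" "x \<noteq> v" "y \<noteq> v"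
    using in_XI[of l l' x] in_XI[of r r' y] at off xy by auto
  then show "\<exists>x\<in>X. F q x < 0" "\<exists>x\<in>X. 0 < F q x"
    using assms(1) xy unfolding mid_def by blast+
qed

text \<open>A closed half-plane that contains all hull vertices contains the hull and so all
  crossings. The factor \<open>s\<close> covers both sides of the line.\<close>

lemma V_side:
  assumes "x \<in> X" "s * F q x < 0"
  shows "\<exists>v\<in>V. s * F q v < 0"
proof (rule ccontr)
  assume "\<not> ?thesis"
  then have "V \<subseteq> {x. (s * a q, s * b q) \<bullet> x \<ge> - s * c q}"
    by (auto simp: F_def inner_prod_def algebra_simps)
  then have "convex hull V \<subseteq> {x. (s * a q, s * b q) \<bullet> x \<ge> - s * c q}"
    by (intro hull_minimal convex_halfspace_ge)
  moreover have "x \<in> convex hull V"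
    using assms(1) hull_V hull_inc by metis
  ultimately show False
    using assms(2) by (auto simp: F_def inner_prod_def algebra_simps)
qed

section \<open>Classifying hull vertices by their middle lines\<close>

definition mid_vertices :: "'i \<Rightarrow> (real \<times> real) set" where
  "mid_vertices q = {v \<in> V. \<exists>l r. mid v q l r}"

lemma mid_verticesD:
  assumes "v \<in> mid_vertices q"
  shows "v \<in> V" "F q v = 0" "q \<in> A" "single q"
proof -
  obtain l r where "v \<in> V" "mid v q l r"
    using assms by (auto simp: mid_vertices_def)
  moreover from mid_single[OF this(2)] show "single q" .
  ultimately show "v \<in> V" "F q v = 0" "q \<in> A"
    by (auto simp: mid_def lines_at_def)
qed

lemma finite_lines_at: "finite (lines_at v)"
  using finite_lines by (simp add: lines_at_def)

lemma card_lines_at: "v \<in> X \<Longrightarrow> 2 \<le> card (lines_at v)"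
proof -
  assume "v \<in> X"
  then obtain i j where "i \<noteq> j" "{i, j} \<subseteq> lines_at v"
    by (auto simp: X_def lines_at_def)
  then show ?thesis
    using card_mono[OF finite_lines_at, of "{i, j}" v] by simp
qed

lemma vertex_cases:
  assumes "v \<in> V"
  shows "v \<in> simple_vertices \<or> (\<exists>q. single q \<and> v \<in> mid_vertices q)"
proof (cases "card (lines_at v) = 2")
  case False
  then have "3 \<le> card (lines_at v)"
    using card_lines_at assms V_subset by (metis Suc_leI eval_nat_numeral(3) le_neq_implies_less subsetD)
  then obtain T where "T \<subseteq> lines_at v" "card T = 3"
    using obtain_subset_with_card_n by metis
  then obtain i j k where "{i, j, k} \<subseteq> lines_at v" "distinct [i, j, k]"
    by (auto simp: card_3_iff)
  then obtain m l r where "mid v m l r"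
    using mid_exists[OF assms] by metis
  then show ?thesis
    using mid_single[of v m l r] assms unfolding mid_vertices_def by blast
qed (use assms in \<open>simp add: simple_vertices_def\<close>)

lemma two_mid_vertices:
  assumes "2 \<le> card (mid_vertices q)"
  obtains x y where "x \<in> V" "y \<in> V" "F q x < 0" "0 < F q y"
proof -
  obtain T where "T \<subseteq> mid_vertices q" "card T = 2"
    using obtain_subset_with_card_n[OF assms] by metis
  then obtain v w l r l' r' where "mid v q l r" "mid w q l' r'" "v \<noteq> w"
    by (auto simp: card_2_iff mid_vertices_def)
  from two_mids(4,5)[OF this] obtain x y where "x \<in> X" "F q x < 0" "y \<in> X" "0 < F q y"
    by blast
  then show ?thesis
    using V_side[of x 1 q] V_side[of y "-1" q] that by auto
qed

text \<open>As \<open>p'\<close> is a middle line twice, there are vertices \<open>v\<close> and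
  \<open>w\<close> strictly on its two sides. They are neither simple nor on \<open>p'\<close>, so
  their middle line is \<open>p\<close>, and \<open>two_mids\<close> yields the parallel
  pairs.\<close>

lemma bad_line_of_two:
  assumes S: "{q. single q} = {p, p'}" and "p \<noteq> p'" "simple_vertices = {}"
    and two: "2 \<le> card (mid_vertices p')"
  shows "bad_line p" "2 \<le> card (mid_vertices p)"
proof -
  have S': "single q \<longleftrightarrow> q = p \<or> q = p'" for q
    using S by (simp add: set_eq_iff)
  have V: "x \<in> mid_vertices p \<or> x \<in> mid_vertices p'" if "x \<in> V" for x
    using vertex_cases[OF that] \<open>simple_vertices = {}\<close> S' by auto
  obtain v w where vw: "v \<in> V" "w \<in> V" "F p' v < 0" "0 < F p' w"
    using two_mid_vertices[OF two] by blast
  then have vw': "v \<in> mid_vertices p" "w \<in> mid_vertices p" "v \<noteq> w"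
    using V[of v] V[of w] mid_verticesD(2)[of v p'] mid_verticesD(2)[of w p'] by auto
  then have "card {v, w} \<le> card (mid_vertices p)"
    by (intro card_mono) (auto simp: mid_vertices_def finite_V)
  then show "2 \<le> card (mid_vertices p)"
    using vw' by simp
  obtain l r l' r' where m: "mid v p l r" "mid w p l' r'"
    using vw' by (auto simp: mid_vertices_def)
  \<comment> \<open>A fourth line \<open>k\<close> through \<open>x\<close> would give a middle line
    among \<open>k\<close>, \<open>l\<close>, \<open>r\<close>. It has no parallel and is not
    \<open>p\<close>, so it is \<open>p'\<close>, which misses \<open>x\<close>.\<close>
  have lines: "lines_at x = {p, l, r}" if x: "mid x p l r" "x \<in> V" "F p' x \<noteq> 0" for x l r
  proof -
    have "k \<in> {p, l, r}" if k: "k \<in> lines_at x" for k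
    proof (rule ccontr)
      assume "k \<notin> {p, l, r}"
      moreover have "{p, l, r} \<subseteq> lines_at x" "distinct [p, l, r]"
        using x(1) by (simp_all add: mid_def)
      ultimately obtain m l' r' where m: "mid x m l' r'" "{m, l', r'} = {k, l, r}"
        using mid_exists[OF x(2), of k l r] k by auto
      have "m \<in> lines_at x" "m \<in> {k, l, r}"
        using m by (auto simp: mid_def)
      moreover have "m = p \<or> m = p'"
        using mid_single[OF m(1)] S' by simp
      ultimately have "m = p'" "F m x = 0"
        using \<open>k \<notin> {p, l, r}\<close> \<open>distinct [p, l, r]\<close> by (auto simp: lines_at_def)
      then show False
        using \<open>k \<notin> {p, l, r}\<close> \<open>distinct [p, l, r]\<close> x(3) by auto
    qed
    then show ?thesis
      using x(1) by (auto simp: mid_def)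
  qed
  show "bad_line p"
    unfolding bad_line_def
    using two_mids(1-3)[OF m vw'(3)] lines[OF m(1) vw(1)] lines[OF m(2) vw(2)] vw vw'(3)
    by (intro bexI[of _ v] bexI[of _ w] exI[of _ l] exI[of _ r] exI[of _ l'] exI[of _ r']) simp_all
qed

text \<open>A line through \<open>v\<close> that misses \<open>w\<close> has no crossing besides
  \<open>v\<close>, so it is parallel to every line missing \<open>v\<close>. Two such lines at
  \<open>v\<close> would be parallel to each other, so there is just one, and the second line
  \<open>h\<close> at \<open>v\<close> joins \<open>v\<close> and \<open>w\<close>. Hence
  \<open>v\<close> and \<open>w\<close> are simple, and \<open>h\<close> has no parallel.\<close>

lemma collinear_case:
  assumes "V = {v, w}" "v \<noteq> w"
  shows "3 \<le> card {q. single q} + card simple_vertices"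
proof -
  have X: "X \<subseteq> closed_segment v w"
    using hull_V assms hull_subset[of X convex] segment_convex_hull by metis
  have step: "\<exists>h l. lines_at v = {l, h} \<and> card (lines_at v) = 2 \<and> single h"
    if vw: "{v, w} \<subseteq> X" "v \<noteq> w" "X \<subseteq> closed_segment v w" for v w
  proof -
    have par: "par l k" if lk: "l \<in> A" "k \<in> A" "F l v = 0" "F l w \<noteq> 0" "F k v \<noteq> 0" for l k
    proof (rule ccontr)
      assume "\<not> par l k"
      then obtain x where x: "F l x = 0" "F k x = 0"
        using meet by metis
      then have "x \<in> X"
        using lk in_XI[of l k x] by auto
      then obtain t where t: "x = (1 - t) *\<^sub>R v + t *\<^sub>R w"
        using vw(3) by (auto simp: closed_segment_def)
      have "F l x = (1 - t) * F l v + t * F l w"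
        by (simp add: t F_def algebra_simps)
      then have "x = v"
        using lk x t by simp
      then show False
        using x lk by simp
    qed
    have ex: "\<exists>l\<in>lines_at v. F l w \<noteq> 0" if "v \<in> X" "v \<noteq> w" for v w
      using that line_unique[of _ _ v w] unfolding X_def lines_at_def by blast
    obtain l l' where l: "l \<in> A" "F l v = 0" "F l w \<noteq> 0" "l' \<in> A" "F l' w = 0" "F l' v \<noteq> 0"
      using ex[of v w] ex[of w v] vw by (auto simp: lines_at_def)
    have u: "m = l" if "m \<in> A" "F m v = 0" "F m w \<noteq> 0" for m
      using par[OF l(1,4,2,3,6)] par[OF that(1) l(4) that(2,3) l(6)] par_trans[OF l(4)] par_sym
        not_par_at[of l m v] l that by blast
    have "\<not> lines_at v \<subseteq> {l}"
      using card_lines_at[of v] vw(1) card_mono[of "{l}" "lines_at v"] by auto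
    then obtain h where h: "h \<in> A" "F h v = 0" "F h w = 0" "h \<noteq> l"
      using u by (auto simp: lines_at_def)
    then have "lines_at v = {l, h}"
      using u l line_unique[of _ h v w] vw(2) unfolding lines_at_def by blast
    moreover have "single h"
      unfolding single_def
    proof (intro conjI ballI impI)
      show "h \<in> A" by (fact h)
      fix k assume k: "k \<in> A" "par h k"
      show "k = h"
      proof (rule ccontr)
        assume "k \<noteq> h"
        then have "F k v \<noteq> 0"
          using not_par_at[of h k v] h k by auto
        then have "par l k"
          using par[OF l(1) k(1) l(2,3)] by simp
        then show False
          using par_trans[OF k(1,2)] par_sym not_par_at[of h l v] h l by blast
      qed
    qed
    ultimately show ?thesis
      using h(4) by auto
  qed
  have "{v, w} \<subseteq> X"
    using assms(1) V_subset by blast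
  then have "v \<in> simple_vertices" "w \<in> simple_vertices" and ne: "{q. single q} \<noteq> {}"
    using step[of v w] step[of w v] X assms by (auto simp: simple_vertices_def closed_segment_commute)
  then have "simple_vertices = {v, w}"
    using assms(1) by (auto simp: simple_vertices_def)
  moreover have "finite {q. single q}"
    using finite_subset[OF _ finite_lines, of "{q. single q}"] by (auto simp: single_def)
  then have "0 < card {q. single q}"
    using ne by (simp add: card_gt_0_iff)
  ultimately show ?thesis
    using assms(2) by simp
qed

text \<open>If there is only one crossing, all lines pass through it, since not all are parallel;
  then no two of them are parallel.\<close>

lemma concurrent_case:
  assumes "V \<subseteq> {v}"
  shows "3 \<le> card {q. single q}"
proof -
  have "convex hull X \<subseteq> {v}"
    using assms hull_V hull_mono[of V "{v}" convex] by simp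
  then have X: "X \<subseteq> {v}"
    using hull_subset[of X convex] by blast
  obtain i j where ij: "i \<in> A" "j \<in> A" "\<not> par i j"
    using not_all_parallel by (auto simp: par_def)
  have through: "F k v = 0" if "k \<in> A" "l \<in> A" "\<not> par k l" for k l
    using meet[OF that(3)] X in_XI[of k l] that by (metis par_def mult.commute singletonD subsetD)
  have all: "F k v = 0" if k: "k \<in> A" for k
  proof -
    have "\<not> par k i \<or> \<not> par k j"
      using par_trans[OF k] par_sym ij by blast
    then show ?thesis
      using through k ij by blast
  qed
  have "{q. single q} = A"
    using not_par_at[of _ _ v] all unfolding single_def by blast
  then show ?thesis
    using three_lines by simp
qed

text \<open>If \<open>q\<close> is the only line without parallel, it is the middle line at one
  vertex at most, or it has vertices strictly on both sides; either way two vertices are simple. If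
  there are two such lines and no simple vertex, one of them is a middle line twice, and
  \<open>bad_line_of_two\<close> applied in both directions makes both of them bad.\<close>

lemma kelly_moser_cases:
  "3 \<le> card {q. single q} + card simple_vertices \<or>
   (\<exists>p p'. p \<noteq> p' \<and> {q. single q} = {p, p'} \<and> bad_line p \<and> bad_line p')"
proof -
  let ?S = "{q. single q}"
  have fS: "finite ?S"
    using finite_subset[OF _ finite_lines, of ?S] by (auto simp: single_def)
  have fV: "finite simple_vertices" "finite (mid_vertices q)" for q
    using finite_V by (auto simp: simple_vertices_def mid_vertices_def)
  consider "card V \<le> 1" | "card V = 2" | "3 \<le> card V" "3 \<le> card ?S" | "3 \<le> card V" "card ?S = 0"
    | "3 \<le> card V" "card ?S = 1" | "3 \<le> card V" "card ?S = 2"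
    by linarith
  then show ?thesis
  proof cases
    case 1
    then have eq: "x = y" if "x \<in> V" "y \<in> V" for x y
      using card_le_Suc0_iff_eq[OF finite_V] that by simp
    \<comment> \<open>The choice operator also covers a formally empty \<open>V\<close>.\<close>
    have "V \<subseteq> {SOME v. v \<in> V}"
      using eq someI[of "\<lambda>v. v \<in> V"] by blast
    from concurrent_case[OF this] show ?thesis
      by simp
  next
    case 2
    then obtain v w where "V = {v, w}" "v \<noteq> w"
      unfolding card_2_iff by blast
    from collinear_case[OF this] show ?thesis ..
  next
    case 4
    then have "\<not> single q" for q
      using fS by simp
    then have "V \<subseteq> simple_vertices"
      using vertex_cases by auto
    then have "card V \<le> card simple_vertices"
      using fV card_mono by blast
    then show ?thesis
      using 4 by simp
  next
    case 5
    then obtain q where q: "?S = {q}"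
      by (auto simp: card_1_singleton_iff)
    have sub: "V \<subseteq> simple_vertices \<union> mid_vertices q"
    proof
      fix v assume "v \<in> V"
      moreover have "p = q" if "single p" for p
        using that q by auto
      ultimately show "v \<in> simple_vertices \<union> mid_vertices q"
        using vertex_cases by blast
    qed
    have "2 \<le> card simple_vertices"
    proof (cases "card (mid_vertices q) \<le> 1")
      case True
      have "card V \<le> card simple_vertices + card (mid_vertices q)"
        using card_mono[OF _ sub] fV card_Un_le[of simple_vertices "mid_vertices q"] by simp
      then show ?thesis
        using True 5 by simp
    next
      case False
      then have "2 \<le> card (mid_vertices q)"
        by simp
      then obtain x y where xy: "x \<in> V" "y \<in> V" "F q x < 0" "0 < F q y"
        using two_mid_vertices by blast
      then have "{x, y} \<subseteq> simple_vertices"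
        using sub mid_verticesD(2)[of x q] mid_verticesD(2)[of y q] by auto
      moreover have "x \<noteq> y"
        using xy by auto
      then have "card {x, y} = 2"
        by simp
      ultimately show ?thesis
        using card_mono[OF fV(1), of "{x, y}"] by simp
    qed
    then show ?thesis
      using q by simp
  next
    case 6
    show ?thesis
    proof (cases "simple_vertices = {}")
      case True
      obtain p p' where p: "?S = {p, p'}" "p \<noteq> p'"
        using 6 by (auto simp: card_2_iff)
      have "V \<subseteq> mid_vertices p \<union> mid_vertices p'"
      proof
        fix v assume "v \<in> V"
        moreover have "q = p \<or> q = p'" if "single q" for q
          using that p(1) by auto
        ultimately show "v \<in> mid_vertices p \<union> mid_vertices p'"
          using vertex_cases True by blast
      qed
      then have "card V \<le> card (mid_vertices p) + card (mid_vertices p')"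
        using card_mono[of "mid_vertices p \<union> mid_vertices p'" V] fV
          card_Un_le[of "mid_vertices p" "mid_vertices p'"] by simp
      then have "2 \<le> card (mid_vertices p) \<or> 2 \<le> card (mid_vertices p')"
        using 6 by linarith
      moreover have p2: "?S = {p', p}" "p' \<noteq> p"
        using p by auto
      ultimately have "bad_line p \<and> bad_line p'"
        using bad_line_of_two[OF p True] bad_line_of_two[OF p2 True] by blast
      then show ?thesis
        using p by blast
    next
      case False
      then have "0 < card simple_vertices"
        using fV by (simp add: card_gt_0_iff)
      then show ?thesis
        using 6 by linarith
    qed
  qed simp
qed

section \<open>The hull argument as a weighted count\<close>

definition corner_pairs :: "('i \<times> 'i) set" where
  "corner_pairs = {(e, f). e \<noteq> f \<and> (\<exists>v\<in>V. lines_at v = {e, f})}"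

lemma card_corner_pairs: "2 * card simple_vertices \<le> card corner_pairs"
proof -
  have fin: "finite corner_pairs"
    by (rule finite_subset[of _ "A \<times> A"]) (auto simp: corner_pairs_def lines_at_def finite_lines)
  have "\<exists>e f. e \<noteq> f \<and> lines_at v = {e, f}" if "v \<in> simple_vertices" for v
    using that by (auto simp: simple_vertices_def card_2_iff)
  then obtain e f where ef: "\<And>v. v \<in> simple_vertices \<Longrightarrow> e v \<noteq> f v \<and> lines_at v = {e v, f v}"
    by metis
  let ?g = "\<lambda>(v, t). if t then (e v, f v) else (f v, e v)"
  have same: "v = w" if "v \<in> simple_vertices" "w \<in> simple_vertices" "lines_at v = lines_at w" for v w
  proof -
    have "{e v, f v} \<subseteq> lines_at v" "{e v, f v} \<subseteq> lines_at w"
      using ef that by auto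
    then show ?thesis
      using line_unique[of "e v" "f v" v w] ef[OF that(1)] by (auto simp: lines_at_def)
  qed
  have inj: "inj_on ?g (simple_vertices \<times> UNIV)"
  proof (rule inj_onI, clarify)
    fix v w and s t :: bool
    assume vw: "v \<in> simple_vertices" "w \<in> simple_vertices"
      and eq: "(if s then (e v, f v) else (f v, e v)) = (if t then (e w, f w) else (f w, e w))"
    then have "lines_at v = lines_at w"
      using ef[OF vw(1)] ef[OF vw(2)] by (auto split: if_splits)
    then have "v = w"
      using same vw by blast
    then show "v = w \<and> s = t"
      using eq ef[OF vw(1)] by (auto split: if_splits)
  qed
  have "card (simple_vertices \<times> (UNIV :: bool set)) \<le> card corner_pairs"
  proof (rule card_inj_on_le[OF inj _ fin], rule image_subsetI, clarify)
    fix v and t :: bool assume v: "v \<in> simple_vertices"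
    have "v \<in> V"
      using v by (simp add: simple_vertices_def)
    then show "(if t then (e v, f v) else (f v, e v)) \<in> corner_pairs"
      using ef[OF v] by (auto simp: corner_pairs_def)
  qed
  then show ?thesis
    by (simp add: card_cartesian_product)
qed

text \<open>The bound 3 is doubled because corners are ordered pairs. In the exceptional case the
  two lines without parallel count 4, and being bad they supply the missing 2.\<close>

theorem kelly_moser_count:
  "6 \<le> 2 * card {q. single q} + card corner_pairs + card {q. single q \<and> bad_line q}"
  using kelly_moser_cases
proof
  assume "3 \<le> card {q. single q} + card simple_vertices"
  then show ?thesis
    using card_corner_pairs by linarith
next
  assume "\<exists>p p'. p \<noteq> p' \<and> {q. single q} = {p, p'} \<and> bad_line p \<and> bad_line p'"
  then obtain p p' where p: "p \<noteq> p'" "{q. single q} = {p, p'}" "bad_line p" "bad_line p'"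
    by blast
  then have "{q. single q \<and> bad_line q} = {p, p'}"
    by auto
  then show ?thesis
    using p by simp
qed

end

section \<open>Extremal points in several coordinates\<close>

definition max_set :: "'a set \<Rightarrow> ('a \<Rightarrow> real) \<Rightarrow> 'a set" where
  "max_set M u = {x \<in> M. \<forall>y\<in>M. u y \<le> u x}"

definition min_set :: "'a set \<Rightarrow> ('a \<Rightarrow> real) \<Rightarrow> 'a set" where
  "min_set M u = {x \<in> M. \<forall>y\<in>M. u x \<le> u y}"

definition ext_set :: "'a set \<Rightarrow> ('a \<Rightarrow> real) \<Rightarrow> 'a set" where
  "ext_set M u = max_set M u \<union> min_set M u"

text \<open>The trace of a \<open>bad_line\<close> on the coordinates of an ordinary conic.\<close>

definition crossed :: "'a set \<Rightarrow> ('a \<Rightarrow> real) \<Rightarrow> ('a \<Rightarrow> real) \<Rightarrow> bool" where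
  "crossed M u w \<longleftrightarrow> (\<exists>p p' r r'. distinct [p, p', r, r'] \<and>
     max_set M u = {p, p'} \<and> min_set M u = {r, r'} \<and> w p = w r' \<and> w p' = w r)"

lemma max_set_eq: "x \<in> max_set M u \<Longrightarrow> y \<in> max_set M u \<Longrightarrow> u x = u y"
  by (auto simp: max_set_def intro: antisym)

lemma min_set_eq: "x \<in> min_set M u \<Longrightarrow> y \<in> min_set M u \<Longrightarrow> u x = u y"
  by (auto simp: min_set_def intro: antisym)

lemma max_set_attained:
  assumes "\<And>x. x \<in> M \<Longrightarrow> u x \<le> m" "z \<in> M" "u z = m"
  shows "max_set M u = {x \<in> M. u x = m}"
  using assms by (auto simp: max_set_def intro: antisym)

lemma min_set_attained:
  assumes "\<And>x. x \<in> M \<Longrightarrow> m \<le> u x" "z \<in> M" "u z = m"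
  shows "min_set M u = {x \<in> M. u x = m}"
  using assms by (auto simp: min_set_def intro: antisym)

lemma affine_max_min:
  fixes c c' :: real
  assumes "\<And>x. x \<in> M \<Longrightarrow> u' x = c * u x + c'" "c \<noteq> 0"
  shows "max_set M u' = max_set M u \<and> min_set M u' = min_set M u \<or>
    max_set M u' = min_set M u \<and> min_set M u' = max_set M u"
proof (cases "0 < c")
  case True
  then show ?thesis
    using assms(1) by (auto simp: max_set_def min_set_def)
next
  case False
  then have "c < 0"
    using assms(2) by simp
  then show ?thesis
    using assms(1) by (auto simp: max_set_def min_set_def)
qed

lemma ext_set_affine:
  fixes c c' :: real
  assumes "\<And>x. x \<in> M \<Longrightarrow> u' x = c * u x + c'" "c \<noteq> 0"
  shows "ext_set M u' = ext_set M u"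
  using affine_max_min[of M u' c u c'] assms by (auto simp: ext_set_def)

text \<open>A negative factor \<open>c\<close> exchanges maxima and minima; \<open>crossed\<close>
  survives this with the two pairs exchanged.\<close>

lemma crossed_affine:
  fixes c c' e e' :: real
  assumes "crossed M u w"
    and "\<And>x. x \<in> M \<Longrightarrow> u' x = c * u x + c'" "c \<noteq> 0"
    and "\<And>x. x \<in> M \<Longrightarrow> w' x = e * w x + e'"
  shows "crossed M u' w'"
proof -
  obtain p p' r r' where p: "distinct [p, p', r, r']" "max_set M u = {p, p'}" "min_set M u = {r, r'}"
      "w p = w r'" "w p' = w r"
    using assms(1) unfolding crossed_def by blast
  have "{p, p', r, r'} \<subseteq> M"
    using p(2,3) by (auto simp: max_set_def min_set_def)
  then have w: "w' p = w' r'" "w' p' = w' r"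
    using p assms(4) by auto
  consider "max_set M u' = {p, p'} \<and> min_set M u' = {r, r'}" | "max_set M u' = {r, r'} \<and> min_set M u' = {p, p'}"
    using affine_max_min[of M u' c u c'] assms(2,3) p by auto
  then show ?thesis
  proof cases
    case 1
    then show ?thesis
      unfolding crossed_def using p(1) w
      by (intro exI[of _ p] exI[of _ p'] exI[of _ r] exI[of _ r']) simp
  next
    case 2
    moreover have "distinct [r, r', p, p']"
      using p(1) by auto
    ultimately show ?thesis
      unfolding crossed_def using w
      by (intro exI[of _ r] exI[of _ r'] exI[of _ p] exI[of _ p']) simp
  qed
qed

text \<open>Such a point is a corner of the bounding box in the coordinates \<open>u\<close> and
  \<open>w\<close>, and is determined by being maximal or minimal in each of them.\<close>

lemma card_ext_Int:
  assumes "\<And>x y. x \<in> M \<Longrightarrow> y \<in> M \<Longrightarrow> u x = u y \<Longrightarrow> w x = w y \<Longrightarrow> x = y"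
  shows "card (ext_set M u \<inter> ext_set M w) \<le> 4"
proof -
  let ?g = "\<lambda>x. (x \<in> max_set M u, x \<in> max_set M w)"
  have "inj_on ?g (ext_set M u \<inter> ext_set M w)"
  proof (rule inj_onI)
    fix x y assume x: "x \<in> ext_set M u \<inter> ext_set M w" and y: "y \<in> ext_set M u \<inter> ext_set M w"
      and eq: "?g x = ?g y"
    have "u x = u y"
      using x y eq max_set_eq[of x M u y] min_set_eq[of x M u y] by (auto simp: ext_set_def)
    moreover have "w x = w y"
      using x y eq max_set_eq[of x M w y] min_set_eq[of x M w y] by (auto simp: ext_set_def)
    moreover have "x \<in> M" "y \<in> M"
      using x y by (auto simp: ext_set_def max_set_def min_set_def)
    ultimately show "x = y"
      using assms by blast
  qed
  then have "card (ext_set M u \<inter> ext_set M w) \<le> card (UNIV :: (bool \<times> bool) set)"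
    by (rule card_inj_on_le) auto
  also have "\<dots> = 4"
    by (simp add: card_UNIV_bool)
  finally show ?thesis .
qed

text \<open>Without crossed coordinates this is 4 times 4. Otherwise \<open>u\<close> has exactly
  four extremal points, and only the coordinates in \<open>P\<close>, at most two of them, can reach
  4 common points. The sum is then at most 12 + 2, and at most 2 coordinates are crossed.\<close>

lemma corner_count:
  fixes w :: "'k \<Rightarrow> 'a \<Rightarrow> real"
  assumes "finite K" "card K = 4"
    and inj: "\<And>k x y. k \<in> K \<Longrightarrow> x \<in> M \<Longrightarrow> y \<in> M \<Longrightarrow> u x = u y \<Longrightarrow> w k x = w k y \<Longrightarrow> x = y"
    and inj2: "\<And>k l x y. k \<in> K \<Longrightarrow> l \<in> K \<Longrightarrow> k \<noteq> l \<Longrightarrow> x \<in> M \<Longrightarrow> y \<in> M \<Longrightarrow>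
       w k x = w k y \<Longrightarrow> w l x = w l y \<Longrightarrow> x = y"
  shows "(\<Sum>k\<in>K. card (ext_set M u \<inter> ext_set M (w k))) + card {k \<in> K. crossed M u (w k)} \<le> 16"
proof (cases "{k \<in> K. crossed M u (w k)} = {}")
  case True
  have "(\<Sum>k\<in>K. card (ext_set M u \<inter> ext_set M (w k))) \<le> (\<Sum>k\<in>K. 4)"
    using inj by (intro sum_mono card_ext_Int) blast
  then show ?thesis
    using True assms(2) by (simp only: card.empty) simp
next
  case False
  then obtain p p' r r' where p: "distinct [p, p', r, r']" "max_set M u = {p, p'}" "min_set M u = {r, r'}"
    unfolding crossed_def by blast
  have M: "p \<in> M" "p' \<in> M" "r \<in> M" "r' \<in> M"
    using p(2,3) by (auto simp: max_set_def min_set_def)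
  have uu: "u p = u p'" "u r = u r'"
    using p(2,3) max_set_eq[of _ M u] min_set_eq[of _ M u] by auto
  define P where "P = {k \<in> K. w k p = w k r \<or> w k p = w k r'}"
  \<comment> \<open>Two coordinates of the family separate points, so only one of them can identify
    \<open>p\<close> with \<open>s\<close>.\<close>
  have le1: "card {k \<in> K. w k p = w k s} \<le> 1" if "s \<in> M" "s \<noteq> p" for s
    using inj2 M(1) that assms(1) by (auto simp: card_le_Suc0_iff_eq)
  have "P = {k \<in> K. w k p = w k r} \<union> {k \<in> K. w k p = w k r'}"
    by (auto simp: P_def)
  then have "card P \<le> card {k \<in> K. w k p = w k r} + card {k \<in> K. w k p = w k r'}"
    by (simp add: card_Un_le)
  then have P: "card P \<le> 2"
    using le1[of r] le1[of r'] M p(1) by fastforce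
  have fP: "finite P"
    using assms(1) by (simp add: P_def)
  have "{k \<in> K. crossed M u (w k)} \<subseteq> P"
  proof
    fix k assume "k \<in> {k \<in> K. crossed M u (w k)}"
    then obtain q q' s s' where k: "k \<in> K" "{p, p'} = {q, q'}" "{r, r'} = {s, s'}"
       "w k q = w k s'" "w k q' = w k s"
      unfolding crossed_def using p(2,3) by auto
    then show "k \<in> P"
      by (auto simp: P_def doubleton_eq_iff)
  qed
  then have C: "card {k \<in> K. crossed M u (w k)} \<le> 2"
    using P card_mono[OF fP] le_trans by blast
  have ext: "ext_set M u = {p, p', r, r'}" "card (ext_set M u) = 4"
    using p by (auto simp: ext_set_def)
  \<comment> \<open>If all four extremal points of \<open>u\<close> are extremal for
    \<open>w k\<close>, then \<open>r\<close> and \<open>r'\<close>, which \<open>u\<close> does not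
    separate, are at opposite extremes of \<open>w k\<close>, and \<open>p\<close> agrees with one
    of them.\<close>
  have full: "k \<in> P" if k: "k \<in> K" "card (ext_set M u \<inter> ext_set M (w k)) \<ge> 4" for k
  proof -
    have "ext_set M u \<inter> ext_set M (w k) = ext_set M u"
      using k(2) ext by (intro card_seteq) auto
    then have e: "p \<in> ext_set M (w k)" "r \<in> ext_set M (w k)" "r' \<in> ext_set M (w k)"
      using ext(1) by auto
    have "w k r \<noteq> w k r'"
      using inj[OF k(1) M(3,4) uu(2)] p(1) by auto
    then have "w k p = w k r \<or> w k p = w k r'"
      using e max_set_eq[of _ M "w k"] min_set_eq[of _ M "w k"] by (auto simp: ext_set_def)
    then show ?thesis
      using k(1) by (simp add: P_def)
  qed
  have "card (ext_set M u \<inter> ext_set M (w k)) \<le> 3 + (if k \<in> P then 1 else 0)" if "k \<in> K" for k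
    using full[OF that] card_ext_Int[of M u "w k"] inj[OF that] by fastforce
  then have "(\<Sum>k\<in>K. card (ext_set M u \<inter> ext_set M (w k))) \<le> (\<Sum>k\<in>K. 3 + (if k \<in> P then 1 else 0))"
    by (rule sum_mono)
  also have "\<dots> = 12 + card (K \<inter> P)"
    using assms(1,2) by (simp add: sum.distrib sum.If_cases)
  also have "card (K \<inter> P) \<le> 2"
    using P by (simp add: P_def Int_def conj_ac)
  finally show ?thesis
    using C by simp
qed

section \<open>Counting in an abstract system of conics\<close>

text \<open>\<open>W\<close> stands for the space of quadratic functions; only its values on \<open>S\<close> matter.\<close>

locale conic_system =
  fixes S :: "'a set" and W :: "('a \<Rightarrow> real) set"
  assumes finite_S: "finite S" and card_S: "7 \<le> card S"
    and comb: "G \<in> W \<Longrightarrow> H \<in> W \<Longrightarrow> (\<lambda>x. s * G x + t * H x) \<in> W"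
    and interpolate: "D \<subseteq> S \<Longrightarrow> card D = 4 \<Longrightarrow> g \<in> S - D \<Longrightarrow> \<exists>H\<in>W. (\<forall>x\<in>D. H x = 0) \<and> H g = 1"
    and through_five: "D \<subseteq> S \<Longrightarrow> card D = 5 \<Longrightarrow> \<exists>G\<in>W. (\<forall>x\<in>D. G x = 0) \<and> (\<exists>x\<in>S. G x \<noteq> 0)"
    and proportional: "\<lbrakk>D \<subseteq> S; card D = 5; G \<in> W; H \<in> W; \<And>z. z \<in> D \<Longrightarrow> G z = 0; \<And>z. z \<in> D \<Longrightarrow> H z = 0;
       x \<in> S; y \<in> S\<rbrakk> \<Longrightarrow> G x * H y = G y * H x"
begin

section \<open>Ordinary five-point sets and their coordinates\<close>

definition ordinary :: "'a set set" where
  "ordinary = {\<Gamma>. \<Gamma> \<subseteq> S \<and> card \<Gamma> = 5 \<and> (\<exists>G\<in>W. \<forall>x\<in>S. G x = 0 \<longleftrightarrow> x \<in> \<Gamma>)}"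

definition eqn :: "'a set \<Rightarrow> 'a \<Rightarrow> real" where
  "eqn \<Gamma> = (SOME G. G \<in> W \<and> (\<forall>x\<in>S. G x = 0 \<longleftrightarrow> x \<in> \<Gamma>))"

definition dual :: "'a set \<Rightarrow> 'a \<Rightarrow> 'a \<Rightarrow> real" where
  "dual \<Gamma> g = (SOME H. H \<in> W \<and> (\<forall>x\<in>\<Gamma> - {g}. H x = 0) \<and> H g = 1)"

text \<open>On \<open>S\<close>, \<open>eqn\<close> is determined up to a factor and
  \<open>dual\<close> up to adding a multiple of \<open>eqn\<close>, so this quotient is determined
  up to an affine map. It is evaluated only on \<open>S - \<Gamma>\<close>, where
  \<open>eqn \<Gamma>\<close> is nonzero.\<close>

definition coord :: "'a set \<Rightarrow> 'a \<Rightarrow> 'a \<Rightarrow> real" where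
  "coord \<Gamma> g x = dual \<Gamma> g x / eqn \<Gamma> x"

lemma ordinaryD: "\<Gamma> \<in> ordinary \<Longrightarrow> \<Gamma> \<subseteq> S \<and> card \<Gamma> = 5 \<and> finite \<Gamma>"
  using finite_S finite_subset by (auto simp: ordinary_def)

lemma finite_ordinary: "finite ordinary"
  by (rule finite_subset[of _ "Pow S"]) (auto simp: ordinary_def finite_S)

lemma eqn:
  assumes "\<Gamma> \<in> ordinary"
  shows "eqn \<Gamma> \<in> W" "x \<in> S \<Longrightarrow> eqn \<Gamma> x = 0 \<longleftrightarrow> x \<in> \<Gamma>"
proof -
  have "\<exists>G. G \<in> W \<and> (\<forall>x\<in>S. G x = 0 \<longleftrightarrow> x \<in> \<Gamma>)"
    using assms by (auto simp: ordinary_def)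
  from someI_ex[OF this] show "eqn \<Gamma> \<in> W" "x \<in> S \<Longrightarrow> eqn \<Gamma> x = 0 \<longleftrightarrow> x \<in> \<Gamma>"
    by (auto simp: eqn_def)
qed

lemma dual:
  assumes "\<Gamma> \<in> ordinary" "g \<in> \<Gamma>"
  shows "dual \<Gamma> g \<in> W" "x \<in> \<Gamma> \<Longrightarrow> x \<noteq> g \<Longrightarrow> dual \<Gamma> g x = 0" "dual \<Gamma> g g = 1"
proof -
  have "\<exists>H. H \<in> W \<and> (\<forall>x\<in>\<Gamma> - {g}. H x = 0) \<and> H g = 1"
    using interpolate[of "\<Gamma> - {g}" g] assms ordinaryD[OF assms(1)] by auto
  from someI_ex[OF this] show "dual \<Gamma> g \<in> W" "x \<in> \<Gamma> \<Longrightarrow> x \<noteq> g \<Longrightarrow> dual \<Gamma> g x = 0" "dual \<Gamma> g g = 1"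
    by (auto simp: dual_def)
qed

text \<open>\<open>G\<close> is proportional to \<open>eqn \<Gamma>\<close>, and
  \<open>dual \<Gamma> g - H / H g\<close> vanishes on \<open>\<Gamma>\<close> and so is a multiple
  of it too. This allows a coordinate to be computed with whatever functions an arrangement
  offers.\<close>

lemma coord_affine:
  assumes \<Gamma>: "\<Gamma> \<in> ordinary" "g \<in> \<Gamma>"
    and G: "G \<in> W" "\<And>x. x \<in> \<Gamma> \<Longrightarrow> G x = 0" "z \<in> S" "G z \<noteq> 0"
    and H: "H \<in> W" "\<And>x. x \<in> \<Gamma> \<Longrightarrow> x \<noteq> g \<Longrightarrow> H x = 0" "H g \<noteq> 0"
  obtains c c' where "c \<noteq> 0" "\<And>x. x \<in> S - \<Gamma> \<Longrightarrow> coord \<Gamma> g x = c * (H x / G x) + c'"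
proof -
  note \<Gamma>D = ordinaryD[OF \<Gamma>(1)]
  have E0: "eqn \<Gamma> x = 0" if "x \<in> \<Gamma>" for x
    using eqn(2)[OF \<Gamma>(1), of x] \<Gamma>D that by auto
  have z: "z \<notin> \<Gamma>" "eqn \<Gamma> z \<noteq> 0"
    using G eqn(2)[OF \<Gamma>(1), of z] by auto
  have "(\<lambda>x. 1 * dual \<Gamma> g x + (- 1 / H g) * H x) \<in> W"
    by (intro comb dual(1) \<Gamma> H)
  moreover have "1 * dual \<Gamma> g x + (- 1 / H g) * H x = 0" if "x \<in> \<Gamma>" for x
    using that H dual(2,3)[OF \<Gamma>] by (cases "x = g") auto
  ultimately have p: "(1 * dual \<Gamma> g x + (- 1 / H g) * H x) * eqn \<Gamma> z
      = (1 * dual \<Gamma> g z + (- 1 / H g) * H z) * eqn \<Gamma> x" if "x \<in> S" for x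
    using proportional[of \<Gamma> "\<lambda>x. 1 * dual \<Gamma> g x + (- 1 / H g) * H x" "eqn \<Gamma>" x z]
      \<Gamma>D E0 eqn(1)[OF \<Gamma>(1)] G(3) that by blast
  have q: "G x * eqn \<Gamma> z = G z * eqn \<Gamma> x" if "x \<in> S" for x
    using proportional[of \<Gamma> G "eqn \<Gamma>" x z] \<Gamma>D E0 eqn(1)[OF \<Gamma>(1)] G that by blast
  define k where "k = dual \<Gamma> g z + (- 1 / H g) * H z"
  define m where "m = G z / eqn \<Gamma> z"
  have m: "m \<noteq> 0"
    using z G by (simp add: m_def)
  have G': "G x = m * eqn \<Gamma> x" if "x \<in> S" for x
    using q[OF that] z by (simp add: m_def field_simps)
  have D': "dual \<Gamma> g x = H x / H g + k / eqn \<Gamma> z * eqn \<Gamma> x" if "x \<in> S" for x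
  proof -
    have "dual \<Gamma> g x + (- 1 / H g) * H x = k / eqn \<Gamma> z * eqn \<Gamma> x"
      using p[OF that] z by (simp add: k_def field_simps)
    then show ?thesis
      by simp
  qed
  show thesis
  proof (rule that[of "m / H g" "k / eqn \<Gamma> z"])
    show "m / H g \<noteq> 0"
      using m H by simp
    fix x assume x: "x \<in> S - \<Gamma>"
    then have "eqn \<Gamma> x \<noteq> 0"
      using eqn(2)[OF \<Gamma>(1)] by auto
    then show "coord \<Gamma> g x = m / H g * (H x / G x) + k / eqn \<Gamma> z"
      using x G'[of x] D'[of x] m by (simp add: coord_def add_divide_distrib)
  qed
qed

text \<open>Let \<open>P g\<close> be the member of the pencil through \<open>\<Gamma> - {g}\<close>
  that vanishes at \<open>x\<close>. Equal coordinates make both \<open>P e\<close> and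
  \<open>P f\<close> vanish at \<open>x\<close>, \<open>y\<close> and the other three points of
  \<open>\<Gamma>\<close>, so they are proportional. But \<open>P e\<close> vanishes at
  \<open>f\<close> and not at \<open>e\<close>, and \<open>P f\<close> the other way round.\<close>

lemma coord_inj:
  assumes \<Gamma>: "\<Gamma> \<in> ordinary" "e \<in> \<Gamma>" "f \<in> \<Gamma>" "e \<noteq> f" and x: "x \<in> S - \<Gamma>" "y \<in> S - \<Gamma>"
    and eq: "coord \<Gamma> e x = coord \<Gamma> e y" "coord \<Gamma> f x = coord \<Gamma> f y"
  shows "x = y"
proof (rule ccontr)
  assume "x \<noteq> y"
  note \<Gamma>D = ordinaryD[OF \<Gamma>(1)]
  have E0: "eqn \<Gamma> z = 0" if "z \<in> \<Gamma>" for z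
    using eqn(2)[OF \<Gamma>(1), of z] \<Gamma>D that by auto
  have E1: "eqn \<Gamma> x \<noteq> 0" "eqn \<Gamma> y \<noteq> 0"
    using eqn(2)[OF \<Gamma>(1)] x by auto
  define P where "P g = (\<lambda>z. coord \<Gamma> g x * eqn \<Gamma> z + (- 1) * dual \<Gamma> g z)" for g
  define D where "D = insert x (insert y (\<Gamma> - {e, f}))"
  have D: "D \<subseteq> S" "card D = 5"
    using \<Gamma> \<Gamma>D x \<open>x \<noteq> y\<close> by (auto simp: D_def card_Diff_subset)
  have PW: "P g \<in> W" if "g \<in> \<Gamma>" for g
    unfolding P_def by (intro comb eqn(1) dual(1) \<Gamma>(1) that)
  have P0: "P g z = 0" if "z \<in> \<Gamma>" "z \<noteq> g" "g \<in> \<Gamma>" for g z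
    using that dual(2)[OF \<Gamma>(1)] E0 by (simp add: P_def)
  have Pg: "P g g = - 1" if "g \<in> \<Gamma>" for g
    using that dual(3)[OF \<Gamma>(1)] E0 by (simp add: P_def)
  have "P e x = 0" "P f x = 0"
    using E1 by (auto simp: P_def coord_def)
  moreover have "P e y = 0" "P f y = 0"
    unfolding P_def eq using E1 by (auto simp: coord_def)
  ultimately have D0: "P e z = 0" "P f z = 0" if "z \<in> D" for z
    using that P0 \<Gamma> by (auto simp: D_def)
  have "P e e * P f f = P e f * P f e"
    using proportional[OF D PW[OF \<Gamma>(2)] PW[OF \<Gamma>(3)] D0, of e f] \<Gamma> \<Gamma>D by auto
  then show False
    using P0[of f e] Pg \<Gamma> by simp
qed

definition extensions :: "'a set \<Rightarrow> 'a set" where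
  "extensions D = {q \<in> S - D. insert q D \<in> ordinary}"

text \<open>What a simple hull vertex for \<open>D\<close>, \<open>d\<close> leaves behind,
  expressed by the five-point set alone so that it can be counted from there. It may contain further
  pairs.\<close>

definition corners :: "'a set \<Rightarrow> 'a \<Rightarrow> ('a \<times> 'a) set" where
  "corners D d = {(e, f). e \<in> S - D \<and> f \<in> S - D \<and> e \<noteq> f \<and> insert e (insert f (D - {d})) \<in> ordinary \<and>
     (let \<Gamma> = insert e (insert f (D - {d})) in
      d \<in> ext_set (S - \<Gamma>) (coord \<Gamma> e) \<inter> ext_set (S - \<Gamma>) (coord \<Gamma> f))}"

definition crossings :: "'a set \<Rightarrow> 'a \<Rightarrow> 'a set" where
  "crossings D d = {q \<in> extensions D. crossed (S - insert q D) (coord (insert q D) d) (coord (insert q D) q)}"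

end

text \<open>The affine plane of conics through \<open>D - {d}\<close> with value 1 at \<open>d\<close> is \<open>Q0 + s Q1 + t Q2\<close>; the point
  \<open>i\<close> becomes the line \<open>Q0 i + s Q1 i + t Q2 i = 0\<close>.\<close>

locale flag = conic_system +
  fixes D d Q0 Q1 Q2 e0
  assumes D: "D \<subseteq> S" "card D = 4" and d: "d \<in> D" and e0: "e0 \<in> S - D"
    and QW: "Q0 \<in> W" "Q1 \<in> W" "Q2 \<in> W"
    and Q1: "\<And>x. x \<in> D \<Longrightarrow> Q1 x = 0" "Q1 e0 = 0" "\<exists>x\<in>S. Q1 x \<noteq> 0"
    and Q2: "\<And>x. x \<in> D \<Longrightarrow> Q2 x = 0" "Q2 e0 = 1"
    and Q0: "\<And>x. x \<in> D \<Longrightarrow> x \<noteq> d \<Longrightarrow> Q0 x = 0" "Q0 d = 1"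
begin

lemma finite_D: "finite D"
  using D finite_S finite_subset by blast

lemma pencil_W: "(\<lambda>x. s * Q1 x + t * Q2 x) \<in> W"
  by (intro comb QW)

lemma net_W: "(\<lambda>x. Q1 x * s + Q2 x * t + Q0 x) \<in> W"
proof -
  have "(\<lambda>x. 1 * (s * Q1 x + t * Q2 x) + 1 * Q0 x) \<in> W"
    by (intro comb[of "\<lambda>x. s * Q1 x + t * Q2 x"] pencil_W QW)
  then show ?thesis
    by (simp add: mult.commute)
qed

text \<open>Otherwise \<open>Q1\<close> and \<open>Q2\<close> both vanish at the five points
  \<open>insert i D\<close> and are proportional, but at \<open>e0\<close> only \<open>Q1\<close>
  vanishes.\<close>

lemma normal:
  assumes "i \<in> S - D"
  shows "Q1 i \<noteq> 0 \<or> Q2 i \<noteq> 0"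
proof (rule ccontr)
  assume neg: "\<not> ?thesis"
  then have "i \<noteq> e0"
    using Q2 by auto
  have "card (insert i D) = 5" "insert i D \<subseteq> S"
    using assms D finite_D by auto
  then have "Q1 x * Q2 e0 = Q1 e0 * Q2 x" if "x \<in> S" for x
    using proportional[of "insert i D" Q1 Q2 x e0] QW Q1 Q2 neg e0 that by auto
  then show False
    using Q1 Q2 by auto
qed

sublocale line_arrangement "S - D" Q1 Q2 Q0
proof
  show "finite (S - D)"
    using finite_S by simp
  \<comment> \<open>This is where the seven points of \<open>S\<close> are used.\<close>
  show "3 \<le> card (S - D)"
    using card_S D finite_D by (simp add: card_Diff_subset)
  show "\<And>i. i \<in> S - D \<Longrightarrow> Q1 i \<noteq> 0 \<or> Q2 i \<noteq> 0"
    by (rule normal)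
  show "\<exists>i\<in>S - D. \<exists>j\<in>S - D. Q1 i * Q2 j \<noteq> Q1 j * Q2 i"
    using Q1 Q2(2) e0 by (metis DiffI mult.right_neutral mult_zero_left)
  fix i j and x :: "real \<times> real"
  assume ij: "i \<in> S - D" "j \<in> S - D" "i \<noteq> j" "Q1 i * Q2 j = Q1 j * Q2 i" "Q1 i * fst x + Q2 i * snd x + Q0 i = 0"
  show "Q1 j * fst x + Q2 j * snd x + Q0 j \<noteq> 0"
  proof
    assume j: "Q1 j * fst x + Q2 j * snd x + Q0 j = 0"
    \<comment> \<open>\<open>?K\<close> is the member through \<open>i\<close> of the pencil of
      \<open>D\<close>; being parallel, \<open>j\<close> lies on it as well. \<open>?L\<close> is
      the conic of the supposed crossing. They share the five points \<open>?E\<close>, but at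
      \<open>d\<close> the values are 0 and 1, so \<open>?K\<close> vanishes on
      \<open>S\<close>.\<close>
    let ?K = "\<lambda>z. Q2 i * Q1 z + (- Q1 i) * Q2 z"
    let ?L = "\<lambda>z. Q1 z * fst x + Q2 z * snd x + Q0 z"
    let ?E = "insert i (insert j (D - {d}))"
    have E: "?E \<subseteq> S" "card ?E = 5"
      using ij D d finite_D by auto
    have E0: "?K z = 0" "?L z = 0" if "z \<in> ?E" for z
      using that ij j Q1 Q2 Q0 by (auto simp: mult.commute)
    have "?K y * ?L d = ?K d * ?L y" if "y \<in> S" for y
      using proportional[OF E pencil_W net_W E0, of y d] d D that by blast
    then have K: "?K y = 0" if "y \<in> S" for y
      using that Q1 Q2 Q0 d by auto
    then have "Q1 i = 0"
      using K[of e0] Q1 Q2 e0 by auto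
    moreover from this have "Q2 i = 0"
      using K Q1(3) by auto
    ultimately show False
      using normal[OF ij(1)] by simp
  qed
qed

text \<open>The member through \<open>q\<close> of the pencil of \<open>D\<close> vanishes at a
  further point exactly if the line of that point is parallel to line \<open>q\<close>.\<close>

lemma single_ordinary:
  assumes "single q"
  shows "q \<in> S - D" "insert q D \<in> ordinary"
    "\<And>x. x \<in> S \<Longrightarrow> - Q2 q * Q1 x + Q1 q * Q2 x = 0 \<longleftrightarrow> x \<in> insert q D"
proof -
  show q: "q \<in> S - D"
    using assms by (simp add: single_def)
  show z: "- Q2 q * Q1 x + Q1 q * Q2 x = 0 \<longleftrightarrow> x \<in> insert q D" if "x \<in> S" for x
    using that assms Q1(1) Q2(1) by (auto simp: single_def par_def)
  have "(\<lambda>x. - Q2 q * Q1 x + Q1 q * Q2 x) \<in> W"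
    by (rule pencil_W)
  moreover have "insert q D \<subseteq> S" "card (insert q D) = 5"
    using q D finite_D by auto
  ultimately show "insert q D \<in> ordinary"
    unfolding ordinary_def using z by (intro CollectI conjI bexI[of _ "\<lambda>x. - Q2 q * Q1 x + Q1 q * Q2 x"]) auto
qed

lemma F_shift: "F x (v + t *\<^sub>R (- Q2 q, Q1 q)) = F x v + t * (- Q2 q * Q1 x + Q1 q * Q2 x)"
  by (simp add: F_def algebra_simps)

text \<open>The point \<open>v\<close> of the parameter plane stands for the conic
  \<open>F x v = 0\<close> in \<open>x\<close>. It contains \<open>D - {d}\<close> and the points
  whose lines pass through \<open>v\<close>, but not \<open>d\<close>.\<close>

lemma vertex_ordinary:
  assumes "lines_at v = {e, f}" "e \<noteq> f"
  shows "e \<in> S - D" "f \<in> S - D" "insert e (insert f (D - {d})) \<in> ordinary"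
    "\<And>x. x \<in> S \<Longrightarrow> F x v = 0 \<longleftrightarrow> x \<in> insert e (insert f (D - {d}))"
proof -
  have ef: "{e, f} \<subseteq> S - D"
    using assms(1) by (auto simp: lines_at_def)
  then show "e \<in> S - D" "f \<in> S - D"
    by auto
  show z: "F x v = 0 \<longleftrightarrow> x \<in> insert e (insert f (D - {d}))" if "x \<in> S" for x
  proof (cases "x \<in> D")
    case True
    then show ?thesis
      using Q1 Q2 Q0 ef by (cases "x = d") (auto simp: F_def)
  next
    case False
    then have "F x v = 0 \<longleftrightarrow> x \<in> lines_at v"
      using that by (simp add: lines_at_def)
    then show ?thesis
      using False assms(1) by auto
  qed
  have "(\<lambda>x. F x v) \<in> W"
    unfolding F_def by (rule net_W)
  moreover have "insert e (insert f (D - {d})) \<subseteq> S" "card (insert e (insert f (D - {d}))) = 5"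
    using ef assms(2) D d finite_D by auto
  ultimately show "insert e (insert f (D - {d})) \<in> ordinary"
    unfolding ordinary_def using z by (intro CollectI conjI bexI[of _ "\<lambda>x. F x v"]) auto
qed

text \<open>Counted from \<open>v\<close>, line \<open>x\<close> meets line \<open>f\<close> at the
  parameter \<open>- F x v / H x\<close>. As \<open>v\<close> is extreme, these parameters have one
  sign, hence so has \<open>H x / F x v\<close>, which is the coordinate of \<open>e\<close> up to
  an affine map. At \<open>d\<close> it is 0, a maximum or a minimum.\<close>

lemma vertex_extreme:
  assumes v: "v \<in> V" and lines: "lines_at v = {e, f}" "e \<noteq> f"
  defines "\<Gamma> \<equiv> insert e (insert f (D - {d}))"
  shows "d \<in> ext_set (S - \<Gamma>) (coord \<Gamma> e)"
proof -
  note ord = vertex_ordinary[OF lines, folded \<Gamma>_def]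
  define H where "H = (\<lambda>x. - Q2 f * Q1 x + Q1 f * Q2 x)"
  have eA: "e \<in> S - D" "f \<in> S - D" "F e v = 0" "F f v = 0"
    using lines by (auto simp: lines_at_def)
  have He: "H e \<noteq> 0"
    using not_par_at[OF eA(1,2) lines(2) eA(3,4)] by (auto simp: H_def par_def algebra_simps)
  have HD: "H x = 0" if "x \<in> D" for x
    using that Q1 Q2 by (simp add: H_def)
  have Hf: "H f = 0"
    by (simp add: H_def)
  have dS: "d \<in> S - \<Gamma>"
    using d D eA by (auto simp: \<Gamma>_def)
  have Fd: "F d v = 1"
    using d Q1 Q2 Q0 by (simp add: F_def)
  have W: "(\<lambda>x. F x v) \<in> W" "H \<in> W"
    unfolding F_def H_def by (rule net_W pencil_W)+
  obtain c c' where c: "c \<noteq> 0" "\<And>x. x \<in> S - \<Gamma> \<Longrightarrow> coord \<Gamma> e x = c * (H x / F x v) + c'"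
  proof (rule coord_affine[OF ord(3) _ W(1) _ _ _ W(2)])
    show "e \<in> \<Gamma>" by (simp add: \<Gamma>_def)
    show "F x v = 0" if "x \<in> \<Gamma>" for x
      using ord(4)[of x] that ordinaryD[OF ord(3)] by auto
    show "d \<in> S" "F d v \<noteq> 0"
      using dS Fd by auto
    show "H x = 0" if "x \<in> \<Gamma>" "x \<noteq> e" for x
      using that HD Hf by (auto simp: \<Gamma>_def)
  qed (use He in auto)
  have cross: "v + (- F x v / H x) *\<^sub>R (- Q2 f, Q1 f) \<in> X" if x: "x \<in> S - \<Gamma>" "H x \<noteq> 0" for x
  proof (rule in_XI[of x f])
    show "x \<in> S - D"
      using x HD by auto
    show "x \<noteq> f" using x Hf by auto
    show "F x (v + (- F x v / H x) *\<^sub>R (- Q2 f, Q1 f)) = 0"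
      unfolding F_shift using x(2) by (simp add: H_def)
    show "F f (v + (- F x v / H x) *\<^sub>R (- Q2 f, Q1 f)) = 0"
      unfolding F_shift using eA by simp
  qed (rule eA)
  have "\<not> (H x / F x v < 0 \<and> 0 < H y / F y v)" if xy: "x \<in> S - \<Gamma>" "y \<in> S - \<Gamma>" for x y
  proof
    assume s: "H x / F x v < 0 \<and> 0 < H y / F y v"
    then have "H x \<noteq> 0" "H y \<noteq> 0"
      by auto
    moreover have "0 < - F x v / H x" "- F y v / H y < 0"
      using s by (auto simp: zero_less_divide_iff divide_less_0_iff)
    ultimately have "(- Q2 f, Q1 f) = 0"
      using same_side[OF v cross[OF xy(2)] cross[OF xy(1)]] by blast
    then show False
      using normal[OF eA(2)] by (simp add: zero_prod_def)
  qed
  then have "(\<forall>y\<in>S - \<Gamma>. H y / F y v \<le> 0) \<or> (\<forall>y\<in>S - \<Gamma>. 0 \<le> H y / F y v)"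
    by (meson not_le)
  then have "d \<in> ext_set (S - \<Gamma>) (\<lambda>x. H x / F x v)"
    using dS HD[OF d] by (auto simp: ext_set_def max_set_def min_set_def)
  then show ?thesis
    using ext_set_affine[of "S - \<Gamma>" "coord \<Gamma> e" c "\<lambda>x. H x / F x v" c'] c by simp
qed

lemma corner_pairs_subset: "corner_pairs \<subseteq> corners D d"
proof (rule subrelI)
  fix e f assume "(e, f) \<in> corner_pairs"
  then obtain v where v: "v \<in> V" "lines_at v = {e, f}" "e \<noteq> f"
    by (auto simp: corner_pairs_def)
  then have v': "lines_at v = {f, e}" "f \<noteq> e"
    by auto
  show "(e, f) \<in> corners D d"
    using vertex_ordinary[OF v(2,3)] vertex_extreme[OF v] vertex_extreme[OF v(1) v'] v(3)
    unfolding corners_def Let_def by (auto simp: insert_commute)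
qed

text \<open>Up to affine maps, the coordinate of \<open>d\<close> is \<open>u\<close>, where
  \<open>- u x\<close> is the position on line \<open>q\<close>, counted from \<open>v\<close>, of
  its crossing with line \<open>x\<close>. The coordinate of \<open>q\<close> depends only on the
  direction of line \<open>x\<close>. So the lines at the ends \<open>v\<close> and \<open>w\<close>
  form the extremal pairs, and the parallels give the crosswise equalities.\<close>

lemma bad_line_crossed:
  assumes q: "single q" and bad: "bad_line q"
  defines "\<Gamma> \<equiv> insert q D"
  shows "crossed (S - \<Gamma>) (coord \<Gamma> d) (coord \<Gamma> q)"
proof -
  note ord = single_ordinary[OF q, folded \<Gamma>_def]
  obtain v w l r l' r' where vw: "v \<in> V" "w \<in> V" "v \<noteq> w" and dist: "distinct [q, l, r, l', r']"
    and lines: "lines_at v = {q, l, r}" "lines_at w = {q, l', r'}" and par: "par l r'" "par r l'"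
    using bad unfolding bad_line_def by blast
  define G where "G = (\<lambda>x. - Q2 q * Q1 x + Q1 q * Q2 x)"
  \<comment> \<open>A second member of the pencil of \<open>D\<close>; its value at \<open>q\<close>
    is the squared length of the normal, hence nonzero.\<close>
  define H where "H = (\<lambda>x. Q1 q * Q1 x + Q2 q * Q2 x)"
  define u where "u = (\<lambda>x. F x v / G x)"
  have G0: "G x = 0 \<longleftrightarrow> x \<in> \<Gamma>" if "x \<in> S" for x
    using ord(3)[OF that] by (simp add: G_def)
  have M: "S - \<Gamma> = (S - D) - {q}"
    by (auto simp: \<Gamma>_def)
  have GM: "G x \<noteq> 0" if "x \<in> S - \<Gamma>" for x
    using G0 that by auto
  have W: "(\<lambda>x. F x v) \<in> W" "G \<in> W" "H \<in> W"
    unfolding F_def G_def H_def by (rule net_W pencil_W)+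
  have qv: "F q v = 0" "F q w = 0"
    using lines by (auto simp: lines_at_def)
  obtain \<tau> where \<tau>: "w = v + \<tau> *\<^sub>R (- Q2 q, Q1 q)"
    using line_param[OF ord(1) qv] by blast
  have dir: "(- Q2 q, Q1 q) \<noteq> 0"
    using normal[OF ord(1)] by (auto simp: zero_prod_def)
  have \<tau>0: "\<tau> \<noteq> 0"
    using \<tau> vw(3) by (auto simp del: scaleR_Pair)
  have cross: "v + (- u x) *\<^sub>R (- Q2 q, Q1 q) \<in> X" if x: "x \<in> S - \<Gamma>" for x
  proof (rule in_XI[of x q])
    show "x \<in> S - D" "x \<noteq> q"
      using x M by auto
    show "F x (v + (- u x) *\<^sub>R (- Q2 q, Q1 q)) = 0"
      unfolding F_shift using GM[OF x] by (simp add: u_def G_def)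
    show "F q (v + (- u x) *\<^sub>R (- Q2 q, Q1 q)) = 0"
      unfolding F_shift using qv by simp
  qed (rule ord)
  have wv: "v + \<tau> *\<^sub>R (- Q2 q, Q1 q) \<in> X" "w + (- \<tau>) *\<^sub>R (- Q2 q, Q1 q) \<in> X"
    using \<tau> vw V_subset by (auto simp del: scaleR_Pair)
  have cross': "w + (- u x - \<tau>) *\<^sub>R (- Q2 q, Q1 q) \<in> X" if x: "x \<in> S - \<Gamma>" for x
    using cross[OF x] by (simp add: \<tau> scaleR_left_diff_distrib del: scaleR_Pair)
  \<comment> \<open>\<open>v\<close> and \<open>w\<close> are both extreme, so every crossing on
    line \<open>q\<close> lies between them.\<close>
  have bounds: "0 \<le> u x \<and> u x \<le> - \<tau> \<or> - \<tau> \<le> u x \<and> u x \<le> 0" if x: "x \<in> S - \<Gamma>" for x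
  proof -
    have "\<not> (\<tau> < 0 \<and> 0 < - u x)" "\<not> (- u x < 0 \<and> 0 < \<tau>)"
      using same_side[OF vw(1) wv(1) cross[OF x]] same_side[OF vw(1) cross[OF x] wv(1)] dir by blast+
    moreover have "\<not> (- \<tau> < 0 \<and> 0 < - u x - \<tau>)" "\<not> (- u x - \<tau> < 0 \<and> 0 < - \<tau>)"
      using same_side[OF vw(2) wv(2) cross'[OF x]] same_side[OF vw(2) cross'[OF x] wv(2)] dir by blast+
    ultimately show ?thesis
      using \<tau>0 by linarith
  qed
  have u0: "u x = 0 \<longleftrightarrow> x \<in> {l, r}" if x: "x \<in> S - \<Gamma>" for x
  proof -
    have "u x = 0 \<longleftrightarrow> x \<in> lines_at v"
      using x M GM by (auto simp: u_def lines_at_def)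
    then show ?thesis
      using lines x by (auto simp: \<Gamma>_def)
  qed
  have u1: "u x = - \<tau> \<longleftrightarrow> x \<in> {l', r'}" if x: "x \<in> S - \<Gamma>" for x
  proof -
    have "F x w = F x v + \<tau> * G x"
      unfolding \<tau> F_shift by (simp add: G_def)
    then have "u x = - \<tau> \<longleftrightarrow> F x w = 0"
      using GM[OF x] by (auto simp: u_def divide_eq_eq)
    then have "u x = - \<tau> \<longleftrightarrow> x \<in> lines_at w"
      using x M by (auto simp: lines_at_def)
    then show ?thesis
      using lines x by (auto simp: \<Gamma>_def)
  qed
  have "{l, r, l', r'} \<subseteq> S - D"
    using lines by (auto simp: lines_at_def)
  then have lM: "{l, r, l', r'} \<subseteq> S - \<Gamma>"
    using dist M by auto
  have ratio: "H x / G x = H y / G y" if "x \<in> S - \<Gamma>" "y \<in> S - \<Gamma>" "par x y" for x y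
  proof -
    have "H x * G y = H y * G x"
      using that(3) unfolding H_def G_def par_def by algebra
    then show ?thesis
      using GM that by (simp add: frac_eq_eq)
  qed
  have r: "H l / G l = H r' / G r'" "H r / G r = H l' / G l'"
    using ratio par lM by auto
  have cr: "crossed (S - \<Gamma>) u (\<lambda>x. H x / G x)"
  proof (cases "0 < \<tau>")
    case True
    then have b: "- \<tau> \<le> u x \<and> u x \<le> 0" if "x \<in> S - \<Gamma>" for x
      using bounds[OF that] by auto
    have "max_set (S - \<Gamma>) u = {x \<in> S - \<Gamma>. u x = 0}"
      using b u0[of l] lM by (intro max_set_attained[of _ _ _ l]) auto
    moreover have "min_set (S - \<Gamma>) u = {x \<in> S - \<Gamma>. u x = - \<tau>}"
      using b u1[of l'] lM by (intro min_set_attained[of _ _ _ l']) auto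
    ultimately have "max_set (S - \<Gamma>) u = {l, r}" "min_set (S - \<Gamma>) u = {l', r'}"
      using u0 u1 lM by auto
    then show ?thesis
      unfolding crossed_def using dist r
      by (intro exI[of _ l] exI[of _ r] exI[of _ l'] exI[of _ r']) simp
  next
    case False
    then have b: "0 \<le> u x \<and> u x \<le> - \<tau>" if "x \<in> S - \<Gamma>" for x
      using bounds[OF that] \<tau>0 by auto
    have "min_set (S - \<Gamma>) u = {x \<in> S - \<Gamma>. u x = 0}"
      using b u0[of l] lM by (intro min_set_attained[of _ _ _ l]) auto
    moreover have "max_set (S - \<Gamma>) u = {x \<in> S - \<Gamma>. u x = - \<tau>}"
      using b u1[of l'] lM by (intro max_set_attained[of _ _ _ l']) auto
    ultimately have "min_set (S - \<Gamma>) u = {l, r}" "max_set (S - \<Gamma>) u = {l', r'}"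
      using u0 u1 lM by auto
    moreover have "distinct [l', r', l, r]"
      using dist by auto
    ultimately show ?thesis
      unfolding crossed_def using r
      by (intro exI[of _ l'] exI[of _ r'] exI[of _ l] exI[of _ r]) simp
  qed
  have G\<Gamma>: "G x = 0" if "x \<in> \<Gamma>" for x
    using G0 that ordinaryD[OF ord(2)] by auto
  have l: "l \<in> S" "G l \<noteq> 0"
    using lM GM by auto
  have dq: "d \<in> \<Gamma>" "q \<in> \<Gamma>"
    using d by (simp_all add: \<Gamma>_def)
  have Fv: "\<And>x. x \<in> \<Gamma> \<Longrightarrow> x \<noteq> d \<Longrightarrow> F x v = 0" "F d v \<noteq> 0"
    using qv Q1 Q2 Q0 d by (auto simp: \<Gamma>_def F_def)
  have Hq: "\<And>x. x \<in> \<Gamma> \<Longrightarrow> x \<noteq> q \<Longrightarrow> H x = 0" "H q \<noteq> 0"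
    using Q1 Q2 normal[OF ord(1)] by (auto simp: \<Gamma>_def H_def sum_squares_eq_zero_iff)
  obtain c c' where c: "c \<noteq> 0" "\<And>x. x \<in> S - \<Gamma> \<Longrightarrow> coord \<Gamma> d x = c * (F x v / G x) + c'"
    using coord_affine[OF ord(2) dq(1) W(2) G\<Gamma> l W(1) Fv] by blast
  obtain k k' where k: "k \<noteq> 0" "\<And>x. x \<in> S - \<Gamma> \<Longrightarrow> coord \<Gamma> q x = k * (H x / G x) + k'"
    using coord_affine[OF ord(2) dq(2) W(2) G\<Gamma> l W(3) Hq] by blast
  show ?thesis
    using crossed_affine[OF cr, of "coord \<Gamma> d" c c' "coord \<Gamma> q" k k'] c k by (simp add: u_def)
qed

lemma six_le: "6 \<le> 2 * card (extensions D) + card (corners D d) + card (crossings D d)"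
proof -
  have fin: "finite (extensions D)" "finite (corners D d)" "finite (crossings D d)"
    using finite_S finite_subset[of "corners D d" "S \<times> S"]
    by (auto simp: extensions_def corners_def crossings_def)
  have "{q. single q} \<subseteq> extensions D"
    using single_ordinary by (auto simp: extensions_def)
  moreover from this have "{q. single q \<and> bad_line q} \<subseteq> crossings D d"
    using bad_line_crossed by (auto simp: crossings_def)
  ultimately have "card {q. single q} \<le> card (extensions D)" "card corner_pairs \<le> card (corners D d)"
    "card {q. single q \<and> bad_line q} \<le> card (crossings D d)"
    using card_mono fin corner_pairs_subset by blast+
  then show ?thesis
    using kelly_moser_count by linarith
qed

end

section \<open>Double counting\<close>

context conic_system
begin

lemma flag_count:
  assumes D: "D \<subseteq> S" "card D = 4" "d \<in> D"
  shows "6 \<le> 2 * card (extensions D) + card (corners D d) + card (crossings D d)"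
proof -
  have fD: "finite D"
    using D finite_S finite_subset by blast
  have "card (S - D) \<noteq> 0"
    using card_S D fD by (simp add: card_Diff_subset)
  then obtain e0 where e0: "e0 \<in> S - D"
    by (metis card.empty ex_in_conv)
  have "card (insert e0 D) = 5" "insert e0 D \<subseteq> S"
    using e0 D fD by auto
  then obtain Q1 where Q1: "Q1 \<in> W" "\<forall>x\<in>insert e0 D. Q1 x = 0" "\<exists>x\<in>S. Q1 x \<noteq> 0"
    using through_five by metis
  obtain Q2 where Q2: "Q2 \<in> W" "\<forall>x\<in>D. Q2 x = 0" "Q2 e0 = 1"
    using interpolate[OF D(1,2) e0] by blast
  \<comment> \<open>Interpolation takes exactly four zeros, so \<open>e0\<close> takes the place of
    \<open>d\<close>.\<close>
  have "insert e0 (D - {d}) \<subseteq> S" "card (insert e0 (D - {d})) = 4" "d \<in> S - insert e0 (D - {d})"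
    using e0 D fD by auto
  then obtain Q0 where Q0: "Q0 \<in> W" "\<forall>x\<in>insert e0 (D - {d}). Q0 x = 0" "Q0 d = 1"
    using interpolate by metis
  interpret flag S W D d Q0 Q1 Q2 e0
    using D e0 Q0 Q1 Q2 by unfold_locales auto
  show ?thesis
    by (rule six_le)
qed

text \<open>There are \<open>4 * (card S choose 4)\<close> flags \<open>(D, d)\<close>, each
  contributing at least 6 by \<open>flag_count\<close>. An ordinary set receives
  \<open>2 * 20\<close> from ordered pairs of its points and at most \<open>5 * 16\<close> from
  corners and crossed coordinates, in total at most 120.\<close>

lemma ordinary_lower_bound: "card S choose 4 \<le> 5 * card ordinary"
proof -
  define \<D> where "\<D> = {D. D \<subseteq> S \<and> card D = 4}"
  define Z where "Z = Sigma \<D> (\<lambda>D. D)"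
  define pairs where "pairs \<Gamma> = Sigma \<Gamma> (\<lambda>d. \<Gamma> - {d})" for \<Gamma> :: "'a set"
  define ext where "ext \<Gamma> g = ext_set (S - \<Gamma>) (coord \<Gamma> g)" for \<Gamma> g
  define cr where "cr \<Gamma> = Sigma \<Gamma> (\<lambda>d. {q \<in> \<Gamma> - {d}. crossed (S - \<Gamma>) (coord \<Gamma> d) (coord \<Gamma> q)})" for \<Gamma>
  have fin\<D>: "finite \<D>"
    using finite_S by (simp add: \<D>_def)
  have finD: "finite D" if "D \<in> \<D>" for D
    using that finite_S finite_subset by (auto simp: \<D>_def)
  have finZ: "finite Z"
    unfolding Z_def using fin\<D> finD by (rule finite_SigmaI)
  have cardZ: "card Z = 4 * (card S choose 4)"
  proof -
    have "card Z = (\<Sum>D\<in>\<D>. card D)"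
      unfolding Z_def using fin\<D> finD by (intro card_SigmaI) auto
    also have "\<dots> = (\<Sum>D\<in>\<D>. 4)"
      by (intro sum.cong) (auto simp: \<D>_def)
    also have "\<dots> = 4 * card \<D>"
      by simp
    also have "card \<D> = card S choose 4"
      unfolding \<D>_def by (rule n_subsets[OF finite_S])
    finally show ?thesis .
  qed
  have fin: "finite (extensions D)" "finite (corners D d)" "finite (crossings D d)" for D d
    using finite_S finite_subset[of "corners D d" "S \<times> S"]
    by (auto simp: extensions_def corners_def crossings_def)
  have finG: "finite \<Gamma>" "card \<Gamma> = 5" "\<Gamma> \<subseteq> S" if "\<Gamma> \<in> ordinary" for \<Gamma>
    using ordinaryD[OF that] by auto
  have finE: "finite (ext \<Gamma> g)" for \<Gamma> g
    using finite_S by (simp add: ext_def ext_set_def max_set_def min_set_def)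
  have finp: "finite (pairs \<Gamma>)" "finite (cr \<Gamma>)" if "\<Gamma> \<in> ordinary" for \<Gamma>
    using finG(1)[OF that] by (auto simp: pairs_def cr_def)

  have A1: "(\<Sum>(D, d)\<in>Z. card (extensions D)) \<le> (\<Sum>\<Gamma>\<in>ordinary. card (pairs \<Gamma>))"
  proof -
    \<comment> \<open>Injective because \<open>D\<close> is recovered by removing \<open>q\<close>
      from the five-point set.\<close>
    let ?g = "\<lambda>((D, d), q). (insert q D, (d, q))"
    have "inj_on ?g (Sigma Z (\<lambda>(D, d). extensions D))"
      by (auto simp: inj_on_def extensions_def Z_def insert_ident)
    moreover have "?g ` Sigma Z (\<lambda>(D, d). extensions D) \<subseteq> Sigma ordinary pairs"
      by (auto simp: extensions_def Z_def pairs_def)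
    moreover have "finite (Sigma ordinary pairs)"
      using finite_ordinary finp by (intro finite_SigmaI)
    ultimately have "card (Sigma Z (\<lambda>(D, d). extensions D)) \<le> card (Sigma ordinary pairs)"
      by (rule card_inj_on_le)
    then show ?thesis
      using finZ fin finite_ordinary finp by (subst (asm) (1 2) card_SigmaI) (auto simp: case_prod_beta)
  qed
  have A2: "(\<Sum>(D, d)\<in>Z. card (corners D d)) \<le>
      (\<Sum>\<Gamma>\<in>ordinary. card (Sigma (pairs \<Gamma>) (\<lambda>(e, f). ext \<Gamma> e \<inter> ext \<Gamma> f)))"
  proof -
    let ?g = "\<lambda>((D, d), (e, f)). (insert e (insert f (D - {d})), ((e, f), d))"
    have "inj_on ?g (Sigma Z (\<lambda>(D, d). corners D d))"
    proof (rule inj_onI)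
      fix x y
      assume x: "x \<in> Sigma Z (\<lambda>(D, d). corners D d)" and y: "y \<in> Sigma Z (\<lambda>(D, d). corners D d)" and eq: "?g x = ?g y"
      obtain D d e f where xx: "x = ((D, d), (e, f))"
        by (metis surj_pair)
      obtain D' d' e' f' where yy: "y = ((D', d'), (e', f'))"
        by (metis surj_pair)
      have s: "e' = e" "f' = f" "d' = d" "insert e (insert f (D - {d})) = insert e (insert f (D' - {d}))"
        using eq by (auto simp: xx yy)
      have "d \<in> D" "e \<notin> D" "f \<notin> D" "d \<in> D'" "e \<notin> D'" "f \<notin> D'"
        using x y s(1-3) by (auto simp: xx yy Z_def corners_def)
      \<comment> \<open>The five-point set lost \<open>d\<close> and gained \<open>e\<close> and
        \<open>f\<close>; undoing this recovers \<open>D\<close>.\<close>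
      then have "D = insert d (insert e (insert f (D - {d})) - {e, f})"
          "D' = insert d (insert e (insert f (D' - {d})) - {e, f})"
        by auto
      then have "D = D'"
        using s(4) by simp
      then show "x = y"
        using s by (simp add: xx yy)
    qed
    moreover have "?g ` Sigma Z (\<lambda>(D, d). corners D d)
        \<subseteq> Sigma ordinary (\<lambda>\<Gamma>. Sigma (pairs \<Gamma>) (\<lambda>(e, f). ext \<Gamma> e \<inter> ext \<Gamma> f))"
      by (auto simp: corners_def Z_def pairs_def ext_def Let_def)
    moreover have "finite (Sigma ordinary (\<lambda>\<Gamma>. Sigma (pairs \<Gamma>) (\<lambda>(e, f). ext \<Gamma> e \<inter> ext \<Gamma> f)))"
      using finite_ordinary finp finE by (intro finite_SigmaI) auto
    ultimately have "card (Sigma Z (\<lambda>(D, d). corners D d))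
        \<le> card (Sigma ordinary (\<lambda>\<Gamma>. Sigma (pairs \<Gamma>) (\<lambda>(e, f). ext \<Gamma> e \<inter> ext \<Gamma> f)))"
      by (rule card_inj_on_le)
    moreover have "card (Sigma Z (\<lambda>(D, d). corners D d)) = (\<Sum>(D, d)\<in>Z. card (corners D d))"
      using finZ fin by (subst card_SigmaI) (auto simp: case_prod_beta)
    moreover have "card (Sigma ordinary (\<lambda>\<Gamma>. Sigma (pairs \<Gamma>) (\<lambda>(e, f). ext \<Gamma> e \<inter> ext \<Gamma> f)))
       = (\<Sum>\<Gamma>\<in>ordinary. card (Sigma (pairs \<Gamma>) (\<lambda>(e, f). ext \<Gamma> e \<inter> ext \<Gamma> f)))"
      using finite_ordinary finp finE by (intro card_SigmaI ballI finite_SigmaI) auto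
    ultimately show ?thesis
      by simp
  qed
  have A3: "(\<Sum>(D, d)\<in>Z. card (crossings D d)) \<le> (\<Sum>\<Gamma>\<in>ordinary. card (cr \<Gamma>))"
  proof -
    let ?g = "\<lambda>((D, d), q). (insert q D, (d, q))"
    have "inj_on ?g (Sigma Z (\<lambda>(D, d). crossings D d))"
      by (auto simp: inj_on_def extensions_def crossings_def Z_def insert_ident)
    moreover have "?g ` Sigma Z (\<lambda>(D, d). crossings D d) \<subseteq> Sigma ordinary cr"
      by (auto simp: extensions_def crossings_def Z_def cr_def)
    moreover have "finite (Sigma ordinary cr)"
      using finite_ordinary finp by (intro finite_SigmaI)
    ultimately have "card (Sigma Z (\<lambda>(D, d). crossings D d)) \<le> card (Sigma ordinary cr)"
      by (rule card_inj_on_le)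
    then show ?thesis
      using finZ fin finite_ordinary finp by (subst (asm) (1 2) card_SigmaI) (auto simp: case_prod_beta)
  qed
  have B1: "card (pairs \<Gamma>) = 20" if "\<Gamma> \<in> ordinary" for \<Gamma>
    using finG[OF that] by (simp add: pairs_def)
  have B2: "card (Sigma (pairs \<Gamma>) (\<lambda>(e, f). ext \<Gamma> e \<inter> ext \<Gamma> f)) + card (cr \<Gamma>) \<le> 80"
    if \<Gamma>: "\<Gamma> \<in> ordinary" for \<Gamma>
  proof -
    have "card (Sigma (pairs \<Gamma>) (\<lambda>(e, f). ext \<Gamma> e \<inter> ext \<Gamma> f)) = (\<Sum>(e, f)\<in>pairs \<Gamma>. card (ext \<Gamma> e \<inter> ext \<Gamma> f))"
      using finp(1)[OF \<Gamma>] finE by (subst card_SigmaI) (auto simp: case_prod_beta)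
    also have "\<dots> = (\<Sum>d\<in>\<Gamma>. \<Sum>f\<in>\<Gamma> - {d}. card (ext \<Gamma> d \<inter> ext \<Gamma> f))"
      unfolding pairs_def using finG(1)[OF \<Gamma>] by (subst sum.Sigma) auto
    finally have 1: "card (Sigma (pairs \<Gamma>) (\<lambda>(e, f). ext \<Gamma> e \<inter> ext \<Gamma> f)) =
       (\<Sum>d\<in>\<Gamma>. \<Sum>f\<in>\<Gamma> - {d}. card (ext \<Gamma> d \<inter> ext \<Gamma> f))" .
    have 2: "card (cr \<Gamma>) = (\<Sum>d\<in>\<Gamma>. card {q \<in> \<Gamma> - {d}. crossed (S - \<Gamma>) (coord \<Gamma> d) (coord \<Gamma> q)})"
      unfolding cr_def using finG(1)[OF \<Gamma>] by (intro card_SigmaI) auto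
    \<comment> \<open>The coordinate of \<open>d\<close> is compared with the four other coordinates
      of \<open>\<Gamma>\<close>.\<close>
    have "(\<Sum>f\<in>\<Gamma> - {d}. card (ext \<Gamma> d \<inter> ext \<Gamma> f)) +
        card {q \<in> \<Gamma> - {d}. crossed (S - \<Gamma>) (coord \<Gamma> d) (coord \<Gamma> q)} \<le> 16" if "d \<in> \<Gamma>" for d
      unfolding ext_def
    proof (rule corner_count)
      show "finite (\<Gamma> - {d})" "card (\<Gamma> - {d}) = 4"
        using finG[OF \<Gamma>] that by auto
    qed (use coord_inj[OF \<Gamma>] that in blast)+
    then have "(\<Sum>d\<in>\<Gamma>. (\<Sum>f\<in>\<Gamma> - {d}. card (ext \<Gamma> d \<inter> ext \<Gamma> f)) +
        card {q \<in> \<Gamma> - {d}. crossed (S - \<Gamma>) (coord \<Gamma> d) (coord \<Gamma> q)}) \<le> (\<Sum>d\<in>\<Gamma>. 16)"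
      by (rule sum_mono)
    then show ?thesis
      using 1 2 finG(2)[OF \<Gamma>] by (simp add: sum.distrib)
  qed
  have "6 * card Z = (\<Sum>(D, d)\<in>Z. 6)"
    by (simp add: case_prod_beta)
  also have "\<dots> \<le> (\<Sum>(D, d)\<in>Z. 2 * card (extensions D) + card (corners D d) + card (crossings D d))"
    using flag_count by (intro sum_mono) (auto simp: Z_def \<D>_def)
  also have "\<dots> = 2 * (\<Sum>(D, d)\<in>Z. card (extensions D)) + (\<Sum>(D, d)\<in>Z. card (corners D d))
      + (\<Sum>(D, d)\<in>Z. card (crossings D d))"
    by (simp add: case_prod_beta sum.distrib sum_distrib_left)
  also have "\<dots> \<le> 2 * (\<Sum>\<Gamma>\<in>ordinary. card (pairs \<Gamma>)) +
      (\<Sum>\<Gamma>\<in>ordinary. card (Sigma (pairs \<Gamma>) (\<lambda>(e, f). ext \<Gamma> e \<inter> ext \<Gamma> f))) + (\<Sum>\<Gamma>\<in>ordinary. card (cr \<Gamma>))"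
    using A1 A2 A3 by linarith
  also have "\<dots> = (\<Sum>\<Gamma>\<in>ordinary. 2 * card (pairs \<Gamma>) +
      (card (Sigma (pairs \<Gamma>) (\<lambda>(e, f). ext \<Gamma> e \<inter> ext \<Gamma> f)) + card (cr \<Gamma>)))"
    by (simp add: sum.distrib sum_distrib_left)
  also have "\<dots> \<le> (\<Sum>\<Gamma>\<in>ordinary. 120)"
    using B1 B2 by (intro sum_mono) fastforce
  finally show ?thesis
    using cardZ by simp
qed

end

section \<open>Conics in the plane\<close>

definition quad :: "real \<Rightarrow> real \<Rightarrow> real \<Rightarrow> real \<Rightarrow> real \<Rightarrow> real \<Rightarrow> real \<times> real \<Rightarrow> real" where
  "quad a b c d e f z = a * (fst z)\<^sup>2 + b * fst z * snd z + c * (snd z)\<^sup>2 + d * fst z + e * snd z + f"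

definition quads :: "(real \<times> real \<Rightarrow> real) set" where
  "quads = {G. \<exists>a b c d e f. G = quad a b c d e f}"

text \<open>Twice the signed area of the triangle. For \<open>p \<noteq> q\<close> it is, in
  \<open>z\<close>, an affine form with the line through \<open>p\<close> and \<open>q\<close> as
  zero set.\<close>

definition area :: "real \<times> real \<Rightarrow> real \<times> real \<Rightarrow> real \<times> real \<Rightarrow> real" where
  "area p q z = (fst q - fst p) * (snd z - snd p) - (snd q - snd p) * (fst z - fst p)"

lemma area_self [simp]: "area p q p = 0" "area p q q = 0"
  by (simp_all add: area_def)

lemma area_midpoint: "area p q ((1/2) *\<^sub>R (x + y)) = (area p q x + area p q y) / 2"
  by (simp add: area_def field_simps)

lemma card_4E:
  assumes "card D = 4"
  obtains p1 p2 p3 p4 where "D = {p1, p2, p3, p4}" "distinct [p1, p2, p3, p4]"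
proof -
  have "finite D"
    using assms card.infinite by fastforce
  then obtain xs where xs: "set xs = D" "distinct xs"
    using finite_distinct_list by blast
  then have "length xs = 4"
    using assms distinct_card by fastforce
  then obtain p1 p2 p3 p4 where "xs = [p1, p2, p3, p4]"
    by (auto simp: numeral_eq_Suc length_Suc_conv)
  then show ?thesis
    using that xs by auto
qed

lemma card_5E:
  assumes "card D = 5"
  obtains p1 p2 p3 p4 p5 where "D = {p1, p2, p3, p4, p5}" "distinct [p1, p2, p3, p4, p5]"
proof -
  have "finite D"
    using assms card.infinite by fastforce
  then obtain xs where xs: "set xs = D" "distinct xs"
    using finite_distinct_list by blast
  then have "length xs = 5"
    using assms distinct_card by fastforce
  then obtain p1 p2 p3 p4 p5 where "xs = [p1, p2, p3, p4, p5]"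
    by (auto simp: numeral_eq_Suc length_Suc_conv)
  then show ?thesis
    using that xs by auto
qed

lemma quad_in_quads: "quad a b c d e f \<in> quads"
  unfolding quads_def by blast

lemma quads_comb:
  assumes "G \<in> quads" "H \<in> quads"
  shows "(\<lambda>z. s * G z + t * H z) \<in> quads"
proof -
  obtain a b c d e f a' b' c' d' e' f' where "G = quad a b c d e f" "H = quad a' b' c' d' e' f'"
    using assms by (auto simp: quads_def)
  then have "(\<lambda>z. s * G z + t * H z) =
      quad (s * a + t * a') (s * b + t * b') (s * c + t * c') (s * d + t * d') (s * e + t * e') (s * f + t * f')"
    by (auto simp: quad_def algebra_simps)
  then show ?thesis
    by (simp only: quad_in_quads)
qed

lemma area_mult_quads: "(\<lambda>z. area p q z * area r s z) \<in> quads"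
proof -
  define A B C A' B' C' where "A = - (snd q - snd p)" and "B = fst q - fst p" and "C = - A * fst p - B * snd p"
    and "A' = - (snd s - snd r)" and "B' = fst s - fst r" and "C' = - A' * fst r - B' * snd r"
  have "area p q z = A * fst z + B * snd z + C" "area r s z = A' * fst z + B' * snd z + C'" for z
    by (simp_all add: area_def A_def B_def C_def A'_def B'_def C'_def algebra_simps)
  then have "(\<lambda>z. area p q z * area r s z) =
      quad (A * A') (A * B' + B * A') (B * B') (A * C' + C * A') (B * C' + C * B') (C * C')"
    by (auto simp: quad_def algebra_simps power2_eq_square)
  then show ?thesis
    by (simp only: quad_in_quads)
qed

lemma collinear_area:
  assumes "area p q z = 0" "p \<noteq> q"
  shows "collinear {p, q, z}"
proof -
  obtain c where c: "z = p + c *\<^sub>R (q - p)"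
  proof (cases "fst q = fst p")
    case True
    with assms show ?thesis
      by (intro that[of "(snd z - snd p) / (snd q - snd p)"]) (auto simp: area_def prod_eq_iff)
  next
    case False
    define c where "c = (fst z - fst p) / (fst q - fst p)"
    have 1: "fst z - fst p = c * (fst q - fst p)"
      using False by (simp add: c_def)
    then have "(fst q - fst p) * (snd z - snd p - c * (snd q - snd p)) = 0"
      using assms(1) unfolding area_def by algebra
    then have "snd z - snd p = c * (snd q - snd p)"
      using False by simp
    with 1 show ?thesis
      by (intro that[of c]) (auto simp: prod_eq_iff algebra_simps)
  qed
  have "\<exists>k. u = p + k *\<^sub>R (q - p)" if "u \<in> {p, q, z}" for u
  proof -
    have "u = p + 0 *\<^sub>R (q - p) \<or> u = p + 1 *\<^sub>R (q - p) \<or> u = p + c *\<^sub>R (q - p)"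
      using that c by auto
    then show ?thesis
      by blast
  qed
  then show ?thesis
    unfolding collinear_alt by blast
qed

section \<open>Quadratic functions with prescribed zeros\<close>

lemma affine_eq_zero:
  assumes "area p q r \<noteq> 0"
    and "a * fst p + b * snd p + c = 0" "a * fst q + b * snd q + c = 0" "a * fst r + b * snd r + c = (0::real)"
  shows "a = 0" "b = 0" "c = 0"
proof -
  have "area p q r * a = 0" "area p q r * b = 0"
    using assms(2-) unfolding area_def by algebra+
  with assms(1) show "a = 0" "b = 0"
    by auto
  with assms(2) show "c = 0"
    by simp
qed

text \<open>Three zeros on the line through \<open>p\<close> and \<open>q\<close> force
  \<open>G\<close> to vanish on it, so \<open>G\<close> is the form of that line times an affine
  function. The latter vanishes at three non-collinear points and is zero.\<close>

lemma quad_eq_zero: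
  assumes G: "G \<in> quads" and "p \<noteq> q"
    and line: "G p = 0" "G q = 0" "G ((1/2) *\<^sub>R (p + q)) = 0"
    and off: "area p q x \<noteq> 0" "area p q y \<noteq> 0" "area p q w \<noteq> 0" "area x y w \<noteq> 0"
    and zero: "G x = 0" "G y = 0" "G w = 0"
  shows "G z = 0"
proof -
  obtain a b c d e f where Gq: "G = quad a b c d e f"
    using G by (auto simp: quads_def)
  define u v where "u = fst q - fst p" and "v = snd q - snd p"
  define N where "N = u\<^sup>2 + v\<^sup>2"
  have N: "N \<noteq> 0"
    using \<open>p \<noteq> q\<close> by (auto simp: N_def u_def v_def sum_power2_eq_zero_iff prod_eq_iff)
  \<comment> \<open>Orthogonal coordinates with \<open>p\<close> as origin and \<open>q\<close> at
    \<open>(1, 0)\<close>; the line is \<open>t = 0\<close>.\<close>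
  define pt where "pt s t = (fst p + s * u - t * v, snd p + s * v + t * u)" for s t
  define A B C D E where "A = a * u\<^sup>2 + b * u * v + c * v\<^sup>2"
    and "B = - 2 * a * u * v + b * (u * u - v * v) + 2 * c * u * v"
    and "C = a * v\<^sup>2 - b * u * v + c * u\<^sup>2"
    and "D = 2 * a * fst p * u + b * (fst p * v + snd p * u) + 2 * c * snd p * v + d * u + e * v"
    and "E = - 2 * a * fst p * v + b * (fst p * u - snd p * v) + 2 * c * snd p * u - d * v + e * u"
  have expand: "G (pt s t) = A * s\<^sup>2 + B * s * t + C * t\<^sup>2 + D * s + E * t + G p" for s t
    unfolding Gq quad_def pt_def A_def B_def C_def D_def E_def fst_conv snd_conv by algebra
  have "q = pt 1 0" "(1/2) *\<^sub>R (p + q) = pt (1/2) 0"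
    by (auto simp: pt_def u_def v_def prod_eq_iff field_simps)
  then have "A + D = 0" "A / 4 + D / 2 = 0"
    using line expand[of 1 0] expand[of "1/2" 0] by (simp_all add: power2_eq_square)
  then have AD: "A = 0" "D = 0"
    by auto
  define S T where "S z = ((fst z - fst p) * u + (snd z - snd p) * v) / N"
    and "T z = (- (fst z - fst p) * v + (snd z - snd p) * u) / N" for z :: "real \<times> real"
  have NST: "N * S z = (fst z - fst p) * u + (snd z - snd p) * v"
    "N * T z = - (fst z - fst p) * v + (snd z - snd p) * u" for z
    using N by (simp_all add: S_def T_def)
  have z_at: "z = pt (S z) (T z)" for z
  proof -
    have "N * (fst z - fst (pt (S z) (T z))) = 0" "N * (snd z - snd (pt (S z) (T z))) = 0"
      using NST[of z] unfolding pt_def N_def fst_conv snd_conv by algebra+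
    then show ?thesis
      using N by (simp add: prod_eq_iff)
  qed
  have Gz: "G z = T z * (B * S z + C * T z + E)" for z
    using expand[of "S z" "T z"] z_at[of z] AD line(1) by (simp add: algebra_simps power2_eq_square)
  have T: "area p q z = N * T z" for z
    unfolding NST by (simp add: area_def u_def v_def algebra_simps)
  have xyw: "B * S x + C * T x + E = 0" "B * S y + C * T y + E = 0" "B * S w + C * T w + E = 0"
    using Gz[of x] Gz[of y] Gz[of w] zero off(1-3) T by auto
  have "N * area x y w = N * N * area (S x, T x) (S y, T y) (S w, T w)"
  proof -
    have "N * N * area (S x, T x) (S y, T y) (S w, T w) =
      (N * S y - N * S x) * (N * T w - N * T x) - (N * T y - N * T x) * (N * S w - N * S x)"
      by (simp add: area_def algebra_simps)
    also have "\<dots> = N * area x y w"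
      unfolding NST unfolding area_def N_def by algebra
    finally show ?thesis ..
  qed
  then have "area (S x, T x) (S y, T y) (S w, T w) \<noteq> 0"
    using off(4) N by auto
  from affine_eq_zero[OF this, of B C E] xyw have "B = 0" "C = 0" "E = 0"
    by auto
  then show ?thesis
    using Gz by simp
qed

text \<open>The combination of \<open>G\<close> and \<open>H\<close> that vanishes at the midpoint
  \<open>m\<close> of \<open>p1\<close> and \<open>p2\<close> has three zeros on one line and three
  more off it, so it is zero. If both vanish at \<open>m\<close>, already \<open>G\<close> is
  zero.\<close>

lemma quads_proportional:
  assumes "G \<in> quads" "H \<in> quads" "distinct [p1, p2, p3, p4, p5]"
    and gp: "\<And>p q r. {p, q, r} \<subseteq> {p1, p2, p3, p4, p5} \<Longrightarrow> distinct [p, q, r] \<Longrightarrow> area p q r \<noteq> 0"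
    and "\<And>z. z \<in> {p1, p2, p3, p4, p5} \<Longrightarrow> G z = 0" "\<And>z. z \<in> {p1, p2, p3, p4, p5} \<Longrightarrow> H z = 0"
  shows "G x * H y = G y * H x"
proof -
  define m where "m = (1/2) *\<^sub>R (p1 + p2)"
  have zero: "K z = 0" if "K \<in> quads" "\<And>z. z \<in> {p1, p2, p3, p4, p5} \<Longrightarrow> K z = 0" "K m = 0" for K z
    using quad_eq_zero[of K p1 p2 p3 p4 p5 z] that assms(3) gp by (simp add: m_def)
  have "(\<lambda>z. G m * H z + (- H m) * G z) \<in> quads"
    by (intro quads_comb assms)
  then have K: "G m * H z = H m * G z" for z
    using zero[of "\<lambda>z. G m * H z + (- H m) * G z" z] assms(5,6) by auto
  show ?thesis
  proof (cases "G m = 0 \<and> H m = 0")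
    case True
    then show ?thesis
      using zero[of G] assms by simp
  next
    case False
    have "G m * (G x * H y - G y * H x) = 0" "H m * (G x * H y - G y * H x) = 0"
      using K[of x] K[of y] by algebra+
    with False show ?thesis
      by auto
  qed
qed

section \<open>Point sets in the plane as a conic system\<close>

locale conic_free =
  fixes S :: "(real \<times> real) set"
  assumes fin: "finite S" and seven: "7 \<le> card S"
    and no_conic: "\<nexists>Q. plane_conic Q \<and> S \<subseteq> Q"
    and no_three: "\<forall>T\<subseteq>S. card T = 3 \<longrightarrow> \<not> collinear T"
begin

lemma area_nonzero:
  assumes "{p, q, r} \<subseteq> S" "distinct [p, q, r]"
  shows "area p q r \<noteq> 0"
proof
  assume "area p q r = 0"
  then have "collinear {p, q, r}"
    using collinear_area assms by auto
  moreover have "card {p, q, r} = 3"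
    using assms(2) by simp
  ultimately show False
    using no_three assms(1) by blast
qed

text \<open>A function of degree at most 1 with three non-collinear zeros is zero.
  \<open>plane_conic\<close> requires degree exactly 2.\<close>

lemma quad_degree:
  assumes "distinct [p, q, r]" "{p, q, r} \<subseteq> S" "\<And>z. z \<in> {p, q, r} \<Longrightarrow> quad a b c d e f z = 0" "quad a b c d e f z \<noteq> 0"
  shows "(a, b, c) \<noteq> (0, 0, 0)"
proof
  assume "(a, b, c) = (0, 0, 0)"
  then have abc: "a = 0" "b = 0" "c = 0"
    by auto
  have "area p q r \<noteq> 0"
    using area_nonzero assms by blast
  from affine_eq_zero[OF this, of d e f] have "d = 0" "e = 0" "f = 0"
    using assms(3)[of p] assms(3)[of q] assms(3)[of r] abc by (auto simp: quad_def)
  then show False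
    using assms(4) abc by (simp add: quad_def)
qed

lemma plane_conic_quad:
  assumes "(a, b, c) \<noteq> (0, 0, 0)"
  shows "plane_conic {z. quad a b c d e f z = 0}"
proof -
  have "{z. quad a b c d e f z = 0} = {(x, y). a * x\<^sup>2 + b * x * y + c * y\<^sup>2 + d * x + e * y + f = 0}"
    by (auto simp: quad_def)
  with assms show ?thesis
    unfolding plane_conic_def by blast
qed

lemma not_vanishing:
  assumes "G \<in> quads" "G z \<noteq> 0" "distinct [p, q, r]" "{p, q, r} \<subseteq> S"
  shows "\<exists>x\<in>S. G x \<noteq> 0"
proof (rule ccontr)
  assume neg: "\<not> ?thesis"
  obtain a b c d e f where G: "G = quad a b c d e f"
    using assms(1) by (auto simp: quads_def)
  have "(a, b, c) \<noteq> (0, 0, 0)"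
    using quad_degree[of p q r a b c d e f z] assms neg G by blast
  then show False
    using plane_conic_quad no_conic neg G by blast
qed

lemma five_points:
  assumes "D \<subseteq> S" "card D = 5"
  obtains p1 p2 p3 p4 p5 where "D = {p1, p2, p3, p4, p5}" "distinct [p1, p2, p3, p4, p5]"
    "\<And>p q r. {p, q, r} \<subseteq> D \<Longrightarrow> distinct [p, q, r] \<Longrightarrow> area p q r \<noteq> 0"
proof -
  obtain p1 p2 p3 p4 p5 where p: "D = {p1, p2, p3, p4, p5}" "distinct [p1, p2, p3, p4, p5]"
    using card_5E[OF assms(2)] .
  show ?thesis
    by (rule that[OF p]) (use area_nonzero assms(1) in blast)
qed

lemma proportional_plane:
  assumes "D \<subseteq> S" "card D = 5" "G \<in> quads" "H \<in> quads" "\<And>z. z \<in> D \<Longrightarrow> G z = 0" "\<And>z. z \<in> D \<Longrightarrow> H z = 0"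
  shows "G x * H y = G y * H x"
proof (rule five_points[OF assms(1,2)])
  fix p1 p2 p3 p4 p5
  assume p: "D = {p1, p2, p3, p4, p5}" "distinct [p1, p2, p3, p4, p5]"
    "\<And>p q r. {p, q, r} \<subseteq> D \<Longrightarrow> distinct [p, q, r] \<Longrightarrow> area p q r \<noteq> 0"
  show ?thesis
    by (rule quads_proportional[OF assms(3,4) p(2) p(3)[unfolded p(1)] assms(5,6)[unfolded p(1)]])
qed

sublocale conic_system S quads
proof
  show "finite S" "7 \<le> card S"
    by (fact fin seven)+
  show "(\<lambda>x. s * G x + t * H x) \<in> quads" if "G \<in> quads" "H \<in> quads" for G H s t
    using that by (rule quads_comb)
  show "G x * H y = G y * H x" if "D \<subseteq> S" "card D = 5" "G \<in> quads" "H \<in> quads"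
    "\<And>z. z \<in> D \<Longrightarrow> G z = 0" "\<And>z. z \<in> D \<Longrightarrow> H z = 0" "x \<in> S" "y \<in> S" for D G H x y
    using that(1-6) by (rule proportional_plane)
  show "\<exists>H\<in>quads. (\<forall>x\<in>D. H x = 0) \<and> H g = 1" if D: "D \<subseteq> S" "card D = 4" "g \<in> S - D" for D g
  proof -
    obtain p1 p2 p3 p4 where p: "D = {p1, p2, p3, p4}" "distinct [p1, p2, p3, p4]"
      using card_4E[OF D(2)] .
    \<comment> \<open>The pair of lines \<open>p1 p2\<close> and \<open>p3 p4\<close> misses
      \<open>g\<close>, since no three points are collinear.\<close>
    define k where "k = area p1 p2 g * area p3 p4 g"
    have k: "k \<noteq> 0"
      using area_nonzero[of p1 p2 g] area_nonzero[of p3 p4 g] p D by (auto simp: k_def)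
    let ?H = "\<lambda>z. (1 / k) * (area p1 p2 z * area p3 p4 z) + 0 * (area p1 p2 z * area p3 p4 z)"
    have "?H \<in> quads"
      by (intro quads_comb area_mult_quads)
    moreover have "?H x = 0" if "x \<in> D" for x
      using that p(1) by auto
    moreover have "?H g = 1"
      using k by (simp add: k_def)
    ultimately show ?thesis
      by (intro bexI[of _ ?H] conjI ballI)
  qed
  show "\<exists>G\<in>quads. (\<forall>x\<in>D. G x = 0) \<and> (\<exists>x\<in>S. G x \<noteq> 0)" if D: "D \<subseteq> S" "card D = 5" for D
  proof (rule five_points[OF D])
    fix p1 p2 p3 p4 p5
    assume p: "D = {p1, p2, p3, p4, p5}" "distinct [p1, p2, p3, p4, p5]"
      "\<And>p q r. {p, q, r} \<subseteq> D \<Longrightarrow> distinct [p, q, r] \<Longrightarrow> area p q r \<noteq> 0"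
    \<comment> \<open>Two line pairs through \<open>p1\<close>, ..., \<open>p4\<close>;
      \<open>G\<close> is the combination of them that also vanishes at \<open>p5\<close>.\<close>
    define H1 where "H1 = (\<lambda>z. area p1 p2 z * area p3 p4 z)"
    define H2 where "H2 = (\<lambda>z. area p1 p3 z * area p2 p4 z)"
    define G where "G = (\<lambda>z. H2 p5 * H1 z + (- H1 p5) * H2 z)"
    have "H1 \<in> quads" "H2 \<in> quads"
      unfolding H1_def H2_def by (rule area_mult_quads)+
    then have W: "G \<in> quads"
      unfolding G_def by (rule quads_comb)
    have zero: "\<forall>x\<in>D. G x = 0"
      by (auto simp: p(1) G_def H1_def H2_def)
    \<comment> \<open>The midpoint lies on the first line pair but not on the second, which shows
      that \<open>G\<close> is not zero.\<close>
    define m where "m = (1/2) *\<^sub>R (p1 + p2)"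
    have m: "H1 m = 0" "H2 m = area p1 p3 p2 * area p2 p4 p1 / 4"
      by (simp_all add: H1_def H2_def m_def area_midpoint)
    have "area p1 p3 p2 \<noteq> 0" "area p2 p4 p1 \<noteq> 0" "area p1 p2 p5 \<noteq> 0" "area p3 p4 p5 \<noteq> 0"
      using p(3)[of p1 p3 p2] p(3)[of p2 p4 p1] p(3)[of p1 p2 p5] p(3)[of p3 p4 p5] p(1,2) by auto
    then have "H1 p5 \<noteq> 0" "H2 m \<noteq> 0"
      by (simp_all add: H1_def m)
    then have "G m \<noteq> 0"
      by (simp add: G_def m(1))
    then have "\<exists>x\<in>S. G x \<noteq> 0"
      using not_vanishing[OF W, of m p1 p2 p3] p(1,2) D(1) by auto
    then show ?thesis
      using W zero by blast
  qed
qed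

text \<open>Uniqueness holds because every quadratic function vanishing on \<open>\<Gamma>\<close>
  is proportional to \<open>eqn \<Gamma>\<close>.\<close>

lemma ordinary_conic_of:
  assumes "\<Gamma> \<in> ordinary"
  shows "ordinary_conic S {z. eqn \<Gamma> z = 0}" "{z. eqn \<Gamma> z = 0} \<inter> S = \<Gamma>"
proof -
  note D = ordinaryD[OF assms]
  show int: "{z. eqn \<Gamma> z = 0} \<inter> S = \<Gamma>"
    using eqn(2)[OF assms] D by blast
  have zero: "eqn \<Gamma> z = 0" if "z \<in> \<Gamma>" for z
    using int that by blast
  obtain p1 p2 p3 p4 p5 where p: "\<Gamma> = {p1, p2, p3, p4, p5}" "distinct [p1, p2, p3, p4, p5]"
    using five_points[of \<Gamma>] D by metis
  have "S - \<Gamma> \<noteq> {}"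
  proof
    assume "S - \<Gamma> = {}"
    then have "card S \<le> card \<Gamma>"
      using D by (intro card_mono) auto
    then show False
      using D seven by simp
  qed
  then obtain y where y: "y \<in> S" "eqn \<Gamma> y \<noteq> 0"
    using eqn(2)[OF assms] by blast
  obtain a b c d e f where G: "eqn \<Gamma> = quad a b c d e f"
    using eqn(1)[OF assms] by (auto simp: quads_def)
  have "(a, b, c) \<noteq> (0, 0, 0)"
    using quad_degree[of p1 p2 p3 a b c d e f y] p D zero y(2) unfolding G by auto
  then have conic: "plane_conic {z. eqn \<Gamma> z = 0}"
    using plane_conic_quad G by simp
  have "Q' = {z. eqn \<Gamma> z = 0}" if Q': "plane_conic Q'" "\<Gamma> \<subseteq> Q'" for Q'
  proof -
    obtain a b c d e f where "Q' = {(x, y). a * x\<^sup>2 + b * x * y + c * y\<^sup>2 + d * x + e * y + f = 0}"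
      using Q'(1) unfolding plane_conic_def by blast
    then have Q: "Q' = {z. quad a b c d e f z = 0}"
      by (auto simp: quad_def)
    have pr: "eqn \<Gamma> x * quad a b c d e f y = eqn \<Gamma> y * quad a b c d e f x" for x y
      using D zero eqn(1)[OF assms] quad_in_quads Q'(2) Q by (intro proportional_plane[of \<Gamma>]) auto
    \<comment> \<open>A point of \<open>S\<close> off \<open>Q'\<close> exists, so the factor of
      proportionality is not 0 and the zero sets agree.\<close>
    obtain w where w: "quad a b c d e f w \<noteq> 0"
      using no_conic Q'(1) Q by blast
    show ?thesis
      unfolding Q using pr[of _ w] pr[of _ y] w y(2) by (metis (lifting) mult_eq_0_iff)
  qed
  then show "ordinary_conic S {z. eqn \<Gamma> z = 0}"
    unfolding ordinary_conic_def int using conic D by blast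
qed

lemma ordinary_conics_ge: "card S choose 4 \<le> 5 * card {Q. ordinary_conic S Q}"
proof -
  have "inj_on (\<lambda>\<Gamma>. {z. eqn \<Gamma> z = 0}) ordinary"
    using ordinary_conic_of(2) by (metis (no_types, lifting) inj_onI)
  then have "card ordinary \<le> card {Q. ordinary_conic S Q}"
    by (rule card_inj_on_le) (auto simp: ordinary_conic_of(1) finite_ordinary_conics fin)
  then show ?thesis
    using ordinary_lower_bound by linarith
qed

end

section \<open>The final estimate\<close>

lemma choose_four: "24 * real (n choose 4) = real n * (real n - 1) * (real n - 2) * (real n - 3)"
  by (simp add: binomial_gbinomial gbinomial_prod_rev eval_nat_numeral fact_prod)

theorem theorem5p1:
  "\<exists>C::real. \<forall>S::(real \<times> real) set.
     finite S \<and> (\<nexists>Q. plane_conic Q \<and> S \<subseteq> Q) \<and>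
     (\<forall>T\<subseteq>S. card T = 3 \<longrightarrow> \<not> collinear T) \<longrightarrow>
     real (card {Q. ordinary_conic S Q}) \<ge> 1 / 120 * real (card S) ^ 4 - C * real (card S) ^ 3"
proof (intro exI[of _ 1] allI impI)
  fix S :: "(real \<times> real) set"
  assume S: "finite S \<and> (\<nexists>Q. plane_conic Q \<and> S \<subseteq> Q) \<and> (\<forall>T\<subseteq>S. card T = 3 \<longrightarrow> \<not> collinear T)"
  let ?n = "real (card S)" and ?c = "real (card {Q. ordinary_conic S Q})"
  \<comment> \<open>For large sets the constant 1 absorbs the term \<open>6 / 120 * ?n ^ 3\<close>
    of the binomial coefficient; for fewer than seven points it makes the left side at most
    0.\<close>
  show "1 / 120 * ?n ^ 4 - 1 * ?n ^ 3 \<le> ?c"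
  proof (cases "7 \<le> card S")
    case True
    then have "conic_free S"
      unfolding conic_free_def using S by blast
    then interpret conic_free S .
    have "real (card S choose 4) \<le> 5 * ?c"
      using ordinary_conics_ge by (metis of_nat_le_iff of_nat_mult of_nat_numeral)
    then have "?n * (?n - 1) * (?n - 2) * (?n - 3) \<le> 120 * ?c"
      using choose_four[of "card S"] by linarith
    moreover have "?n ^ 4 - 120 * ?n ^ 3 \<le> ?n * (?n - 1) * (?n - 2) * (?n - 3)"
    proof -
      have "?n * (?n - 1) * (?n - 2) * (?n - 3) - (?n ^ 4 - 120 * ?n ^ 3) = 114 * ?n ^ 3 + 11 * ?n\<^sup>2 - 6 * ?n"
        by algebra
      moreover have "6 * ?n \<le> 11 * ?n\<^sup>2"
        using True by (simp add: power2_eq_square)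
      moreover have "0 \<le> 114 * ?n ^ 3"
        by simp
      ultimately show ?thesis
        by linarith
    qed
    ultimately show ?thesis
      by linarith
  next
    case False
    then have "?n * ?n ^ 3 \<le> 120 * ?n ^ 3"
      by (intro mult_right_mono) auto
    then have "1 / 120 * ?n ^ 4 - 1 * ?n ^ 3 \<le> 0"
      by (simp add: eval_nat_numeral)
    then show ?thesis
      using of_nat_0_le_iff order_trans by blast
  qed
qed

end
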